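(* Fix $T\in(0,\infty)$. Let $J^\alpha$ be a family of continuous linear operators $\mathrm{L}^1(0,T)\rightarrow\mathrm{L}^1(0,T)$, for $\alpha\in(0,\infty)$. Suppose: - Identity: $J^1f$ is the ordinary integral; - Index law: $J^{\alpha+\beta}=J^\alpha\circ J^\beta$ on $\mathrm{L}^1(0,T)$ for all $\alpha,\beta\in(0,\infty)$; - Continuity: the map $\alpha\mapsto J^\alpha 1$ from $(0,\infty)$ to $\mathrm{L}^1(0,T)$ is continuous at one point. Then $J^\alpha=I^\alpha$ is the Riemann-Liouville integral on $\mathrm{L}^1(0,T)$, for all $\alpha\in(0,\infty)$.
   Context: $\mathrm{L}^1(0,T)$ consists of real-valued functions; $1$ is the constant function. The ordinary integral is $f\mapsto\int_0^tf(s)\,\mathrm{d}s$. $I^\alpha f(t)=\frac{1}{\Gamma(\alpha)}\int_0^t(t-s)^{\alpha-1}f(s)\,\mathrm{d}s$ is the Riemann-Liouville integral with left origin $0$. *)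

theory Defs
  imports "HOL-Analysis.Analysis"
begin

text \<open>
  Elements of \<open>L\<^sup>1(0,T)\<close> are represented by Lebesgue integrable functions on the open interval;
  values outside \<open>(0,T)\<close> are irrelevant. Equality in \<open>L\<^sup>1(0,T)\<close> is equality almost everywhere,
  \<open>L1_eq\<close>. An operator on \<open>L\<^sup>1(0,T)\<close> is a map on representatives that respects \<open>L1_eq\<close>.
\<close>

definition L1 :: "real \<Rightarrow> (real \<Rightarrow> real) set" where
  "L1 T = {f. integrable (lebesgue_on {0<..<T}) f}"

definition L1_eq :: "real \<Rightarrow> (real \<Rightarrow> real) \<Rightarrow> (real \<Rightarrow> real) \<Rightarrow> bool" where
  "L1_eq T f g \<longleftrightarrow> (AE t in lebesgue_on {0<..<T}. f t = g t)"

definition L1_dist :: "real \<Rightarrow> (real \<Rightarrow> real) \<Rightarrow> (real \<Rightarrow> real) \<Rightarrow> real" where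
  "L1_dist T f g = (\<integral>t. \<bar>f t - g t\<bar> \<partial>lebesgue_on {0<..<T})"

definition L1_operator :: "real \<Rightarrow> ((real \<Rightarrow> real) \<Rightarrow> (real \<Rightarrow> real)) \<Rightarrow> bool" where
  "L1_operator T A \<longleftrightarrow>
     (\<forall>f\<in>L1 T. A f \<in> L1 T) \<and>
     (\<forall>f\<in>L1 T. \<forall>g\<in>L1 T. L1_eq T f g \<longrightarrow> L1_eq T (A f) (A g))"

definition L1_linear :: "real \<Rightarrow> ((real \<Rightarrow> real) \<Rightarrow> (real \<Rightarrow> real)) \<Rightarrow> bool" where
  "L1_linear T A \<longleftrightarrow>
     (\<forall>f\<in>L1 T. \<forall>g\<in>L1 T. L1_eq T (A (\<lambda>t. f t + g t)) (\<lambda>t. A f t + A g t)) \<and>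
     (\<forall>c. \<forall>f\<in>L1 T. L1_eq T (A (\<lambda>t. c * f t)) (\<lambda>t. c * A f t))"

definition L1_continuous :: "real \<Rightarrow> ((real \<Rightarrow> real) \<Rightarrow> (real \<Rightarrow> real)) \<Rightarrow> bool" where
  "L1_continuous T A \<longleftrightarrow>
     (\<forall>f\<in>L1 T. \<forall>\<epsilon>>0. \<exists>\<delta>>0. \<forall>g\<in>L1 T. L1_dist T g f < \<delta> \<longrightarrow> L1_dist T (A g) (A f) < \<epsilon>)"

definition ordinary_integral :: "(real \<Rightarrow> real) \<Rightarrow> real \<Rightarrow> real" where
  "ordinary_integral f t = (\<integral>s. f s \<partial>lebesgue_on {0<..<t})"

text \<open>
  For \<open>\<alpha> < 1\<close> and \<open>f\<close> in \<open>L\<^sup>1(0,T)\<close> the integrand below is integrable for almost every \<open>t\<close> in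
  \<open>(0,T)\<close>; at the exceptional points the Bochner integral takes the default value \<open>0\<close>.
\<close>

definition riemann_liouville :: "real \<Rightarrow> (real \<Rightarrow> real) \<Rightarrow> real \<Rightarrow> real" where
  "riemann_liouville \<alpha> f t =
     1 / Gamma \<alpha> * (\<integral>s. (t - s) powr (\<alpha> - 1) * f s \<partial>lebesgue_on {0<..<t})"

end

theory Submission
  imports Defs "HOL-Real_Asymp.Real_Asymp"
begin

text \<open>
  Let \<open>V = J\<^sup>1\<close> be integration and \<open>u\<^sub>\<alpha> = J\<^sup>\<alpha> 1\<close>. Since \<open>J\<^sup>\<alpha>\<close> commutes with \<open>V\<close> and is continuous,
  the identity \<open>V (J\<^sup>\<alpha> f) = u\<^sub>\<alpha> * f\<close> (convolution), which holds for \<open>f = 1\<close>, passes to polynomials,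
  to continuous functions by Weierstrass, and to all of \<open>L\<^sup>1\<close> by injectivity of \<open>V\<close>. The index law
  then reads \<open>u\<^sub>\<alpha> * u\<^sub>\<beta> = 1 * u\<^bsub>\<alpha>+\<beta>\<^esub>\<close> on \<open>(0,T)\<close>. On the Laplace side, \<open>B\<^sub>\<alpha>(s) = s \<integral>\<^sub>0\<^sup>T e\<^bsup>-st\<^esup> u\<^sub>\<alpha>(t) dt\<close>
  satisfies \<open>B\<^sub>\<alpha> B\<^sub>\<beta> = B\<^bsub>\<alpha>+\<beta>\<^esub>\<close> up to errors \<open>O(e\<^bsup>-\<rho>s\<^esup>)\<close> for every \<open>\<rho> < T\<close>, and a function on \<open>(0,T)\<close>
  whose transform is of that size vanishes. For \<open>\<alpha> = p/q\<close> the nonnegative function \<open>z = B\<^bsub>\<alpha>/2\<^esub>\<^sup>2\<close>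
  agrees with \<open>B\<^sub>\<alpha>\<close> and \<open>z\<^sup>q\<close> with \<open>B\<^sub>p = s\<^bsup>-p\<^esup>\<close> up to such errors, so \<open>B\<^sub>\<alpha> = s\<^bsup>-\<alpha>\<^esup>\<close> and
  \<open>u\<^sub>\<alpha> = t\<^sup>\<alpha> / \<Gamma>(\<alpha> + 1)\<close>. Working with real \<open>s\<close> and extracting nonnegative roots replaces Titchmarsh's
  convolution theorem. Continuity at \<open>\<alpha>\<^sub>0\<close> together with the index law extends the formula to all
  \<open>\<alpha> > \<alpha>\<^sub>0\<close>, and injectivity of \<open>V\<close> brings it down to all \<open>\<alpha> > 0\<close>.
\<close>

subsection \<open>Convolution and integration\<close>

text \<open>Starting at minus infinity lets integration commute with convolution on the whole line,
  with no boundary terms. For functions that vanish on the negative half-line it is the integral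
  from 0.\<close>

definition prim :: "(real \<Rightarrow> real) \<Rightarrow> real \<Rightarrow> real" where
  "prim f t = (\<integral>x. indicator {..<t} x * f x \<partial>lborel)"

text \<open>When both factors are supported in (0,T), this is the usual integral over (0,t) for t in
  (0,T). Where the integrand is not integrable the value is the default 0, so linearity can only be
  expected almost everywhere.\<close>

definition conv :: "(real \<Rightarrow> real) \<Rightarrow> (real \<Rightarrow> real) \<Rightarrow> real \<Rightarrow> real" where
  "conv f g t = (\<integral>y. f (t - y) * g y \<partial>lborel)"

definition norm1 :: "(real \<Rightarrow> real) \<Rightarrow> real" where
  "norm1 f = (\<integral>x. \<bar>f x\<bar> \<partial>lborel)"

lemma integrable_bounded_mult:
  fixes f :: "real \<Rightarrow> real"
  assumes f: "integrable lborel f" and [measurable]: "\<phi> \<in> borel_measurable borel"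
    and b: "\<And>x. \<bar>\<phi> x\<bar> \<le> c"
  shows "integrable lborel (\<lambda>x. \<phi> x * f x)"
proof (rule Bochner_Integration.integrable_bound[of _ "\<lambda>x. c * f x"])
  show "integrable lborel (\<lambda>x. c * f x)" using f by simp
  show "(\<lambda>x. \<phi> x * f x) \<in> borel_measurable lborel" using f by simp
  have "c \<ge> 0" using b[of 0] by linarith
  then show "AE x in lborel. norm (\<phi> x * f x) \<le> norm (c * f x)"
    using b by (intro always_eventually allI) (simp add: abs_mult mult_right_mono)
qed

lemma integrable_indicator_mult:
  fixes f :: "real \<Rightarrow> real"
  assumes "integrable lborel f" "A \<in> sets borel"
  shows "integrable lborel (\<lambda>x. indicator A x * f x)"
  by (rule integrable_bounded_mult[OF assms(1), where c = 1]) (use assms(2) in \<open>auto simp: indicator_def\<close>)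

lemma integrable_translate:
  fixes f :: "real \<Rightarrow> real"
  assumes "integrable lborel f" shows "integrable lborel (\<lambda>x. f (x - y))"
  using lborel_integrable_real_affine[OF assms, of "1" "-y"] by simp

lemma integral_translate:
  fixes f :: "real \<Rightarrow> real"
  shows "(\<integral>x. f (x - y) \<partial>lborel) = (\<integral>x. f x \<partial>lborel)"
  using lborel_integral_real_affine[of 1 f "-y"] by simp

lemma conv_commute: "conv f g = conv g f"
proof
  fix t
  show "conv f g t = conv g f t"
    unfolding conv_def
    using lborel_integral_real_affine[of "-1" "\<lambda>y. f (t - y) * g y" t] by (simp add: mult.commute)
qed

lemma conv_AE_cong:
  assumes "AE x in lborel. g x = g' x" and [measurable]: "g \<in> borel_measurable borel" "g' \<in> borel_measurable borel"
    "f \<in> borel_measurable borel"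
  shows "conv f g = conv f g'"
proof
  fix t show "conv f g t = conv f g' t"
    unfolding conv_def
    by (rule integral_cong_AE) (use assms(1) in \<open>auto elim: eventually_mono\<close>)
qed

lemma prim_AE_cong:
  assumes "AE x in lborel. g x = g' x" and [measurable]: "g \<in> borel_measurable borel" "g' \<in> borel_measurable borel"
  shows "prim g = prim g'"
proof
  fix t show "prim g t = prim g' t"
    unfolding prim_def
    by (rule integral_cong_AE) (use assms(1) in \<open>auto elim: eventually_mono\<close>)
qed

lemma abs_integral_le_norm1:
  assumes f: "integrable lborel f" and [measurable]: "\<phi> \<in> borel_measurable borel"
    and b: "\<And>x. \<bar>\<phi> x\<bar> \<le> c"
  shows "\<bar>\<integral>x. \<phi> x * f x \<partial>lborel\<bar> \<le> c * norm1 f"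
proof -
  have "\<bar>\<integral>x. \<phi> x * f x \<partial>lborel\<bar> \<le> (\<integral>x. \<bar>\<phi> x * f x\<bar> \<partial>lborel)"
    by (rule integral_abs_bound)
  also have "\<dots> \<le> (\<integral>x. c * \<bar>f x\<bar> \<partial>lborel)"
    by (rule integral_mono)
      (use integrable_abs[OF integrable_bounded_mult[OF assms]] b f in \<open>auto simp: abs_mult mult_right_mono\<close>)
  finally show ?thesis by (simp add: norm1_def)
qed

lemma norm1_nonneg: "norm1 f \<ge> 0"
  by (simp add: norm1_def)

context
  fixes f g :: "real \<Rightarrow> real"
  assumes f: "integrable lborel f" and g: "integrable lborel g"
begin

text \<open>Tonelli: for fixed y, translation invariance gives the inner integral the value \<bar>g
  y\<bar> times \<open>norm1 f\<close>, which is integrable in y.\<close>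

lemma integrable_conv_pair:
  "integrable (lborel \<Otimes>\<^sub>M lborel) (\<lambda>(t, y). f (t - y) * g y)"
proof -
  note [measurable] = borel_measurable_integrable[OF f] borel_measurable_integrable[OF g]
  have "integrable (lborel \<Otimes>\<^sub>M lborel) (\<lambda>(y, t). f (t - y) * g y)"
  proof (rule lborel_pair.Fubini_integrable)
    show "(\<lambda>(y, t). f (t - y) * g y) \<in> borel_measurable (lborel \<Otimes>\<^sub>M lborel)" by measurable
    have "(\<integral>t. norm (f (t - y) * g y) \<partial>lborel) = \<bar>g y\<bar> * norm1 f" for y
      using integral_translate[of "\<lambda>x. \<bar>f x\<bar>" y] by (simp add: abs_mult norm1_def mult.commute)
    then show "integrable lborel (\<lambda>y. \<integral>t. norm (case (y, t) of (y, t) \<Rightarrow> f (t - y) * g y) \<partial>lborel)"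
      using g by simp
    show "AE y in lborel. integrable lborel (\<lambda>t. case (y, t) of (y, t) \<Rightarrow> f (t - y) * g y)"
      using integrable_translate[OF f] by simp
  qed
  from lborel_pair.integrable_product_swap[OF this] show ?thesis
    by (simp add: case_prod_beta)
qed

lemma integrable_conv: "integrable lborel (conv f g)"
  unfolding conv_def using lborel_pair.integrable_fst[OF integrable_conv_pair] by simp

text \<open>Fubini against a bounded weight \<phi>. The indicator of a half-line, the sign of the
  convolution and a truncated exponential as weights yield \<open>prim_conv\<close>,
  \<open>norm1_conv\<close> and \<open>laplace_conv\<close>.\<close>

lemma integral_conv:
  assumes [measurable]: "\<phi> \<in> borel_measurable borel" and b: "\<And>x. \<bar>\<phi> x\<bar> \<le> c"
  shows "(\<integral>t. \<phi> t * conv f g t \<partial>lborel) = (\<integral>y. (\<integral>x. \<phi> (x + y) * f x \<partial>lborel) * g y \<partial>lborel)"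
    and "integrable lborel (\<lambda>y. (\<integral>x. \<phi> (x + y) * f x \<partial>lborel) * g y)"
proof -
  note [measurable] = borel_measurable_integrable[OF f] borel_measurable_integrable[OF g]
  have int: "integrable (lborel \<Otimes>\<^sub>M lborel) (\<lambda>(t, y). \<phi> t * (f (t - y) * g y))"
  proof (rule Bochner_Integration.integrable_bound)
    show "integrable (lborel \<Otimes>\<^sub>M lborel) (\<lambda>p. c * (case p of (t, y) \<Rightarrow> f (t - y) * g y))"
      using integrable_conv_pair by simp
    show "(\<lambda>(t, y). \<phi> t * (f (t - y) * g y)) \<in> borel_measurable (lborel \<Otimes>\<^sub>M lborel)" by measurable
    have "c \<ge> 0" using b[of 0] by linarith
    then show "AE p in lborel \<Otimes>\<^sub>M lborel. norm (case p of (t, y) \<Rightarrow> \<phi> t * (f (t - y) * g y))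
        \<le> norm (c * (case p of (t, y) \<Rightarrow> f (t - y) * g y))"
      using b by (intro always_eventually allI) (auto simp: abs_mult intro!: mult_right_mono)
  qed
  have eq: "(\<integral>t. \<phi> t * (f (t - y) * g y) \<partial>lborel) = (\<integral>x. \<phi> (x + y) * f x \<partial>lborel) * g y" for y
    using integral_translate[of "\<lambda>x. \<phi> (x + y) * f x * g y" y] by (simp add: mult.assoc[symmetric])
  have "(\<integral>t. \<phi> t * conv f g t \<partial>lborel) = (\<integral>t. (\<integral>y. \<phi> t * (f (t - y) * g y) \<partial>lborel) \<partial>lborel)"
    by (simp add: conv_def)
  also have "\<dots> = (\<integral>y. (\<integral>t. \<phi> t * (f (t - y) * g y) \<partial>lborel) \<partial>lborel)"
    using lborel_pair.integral_fst[OF int] lborel_pair.integral_snd[OF int] by simp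
  finally show "(\<integral>t. \<phi> t * conv f g t \<partial>lborel) = (\<integral>y. (\<integral>x. \<phi> (x + y) * f x \<partial>lborel) * g y \<partial>lborel)"
    by (simp add: eq)
  show "integrable lborel (\<lambda>y. (\<integral>x. \<phi> (x + y) * f x \<partial>lborel) * g y)"
    using lborel_pair.integrable_snd[OF int] by (simp add: eq)
qed

lemma prim_conv: "prim (conv f g) t = conv (prim f) g t"
proof -
  have "prim (conv f g) t = (\<integral>y. (\<integral>x. indicator {..<t} (x + y) * f x \<partial>lborel) * g y \<partial>lborel)"
    unfolding prim_def by (rule integral_conv(1)[where c = 1]) (auto simp: indicator_def)
  also have "(\<lambda>y. (\<integral>x. indicator {..<t} (x + y) * f x \<partial>lborel)) = (\<lambda>y. prim f (t - y))"
    unfolding prim_def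
    by (intro ext Bochner_Integration.integral_cong) (auto simp: indicator_def)
  finally show ?thesis by (simp only: conv_def[of "prim f"])
qed

lemma norm1_conv: "norm1 (conv f g) \<le> norm1 f * norm1 g"
proof -
  note [measurable] = borel_measurable_integrable[OF f] borel_measurable_integrable[OF g]
  \<comment> \<open>The sign as weight turns the norm into a linear expression in the convolution,
    to which \<open>integral_conv\<close> applies.\<close>
  define \<phi> where "\<phi> = (\<lambda>t. sgn (conv f g t))"
  have [measurable]: "conv f g \<in> borel_measurable borel"
    using integrable_conv by simp
  have m[measurable]: "\<phi> \<in> borel_measurable borel"
    unfolding \<phi>_def by measurable
  have b: "\<bar>\<phi> x\<bar> \<le> 1" for x by (auto simp: \<phi>_def sgn_if)
  have inner: "\<bar>\<integral>x. \<phi> (x + y) * f x \<partial>lborel\<bar> \<le> norm1 f" for y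
    using abs_integral_le_norm1[OF f, of "\<lambda>x. \<phi> (x + y)" 1] b by simp
  have "norm1 (conv f g) = (\<integral>t. \<phi> t * conv f g t \<partial>lborel)"
    by (simp add: norm1_def \<phi>_def abs_sgn mult.commute)
  also have "\<dots> = (\<integral>y. (\<integral>x. \<phi> (x + y) * f x \<partial>lborel) * g y \<partial>lborel)"
    by (rule integral_conv(1)[OF m b])
  also have "\<dots> \<le> norm1 f * norm1 g"
    using abs_integral_le_norm1[OF g, of "\<lambda>y. \<integral>x. \<phi> (x + y) * f x \<partial>lborel" "norm1 f"] inner by simp
  finally show ?thesis .
qed

end

text \<open>Dominated convergence: the indicators of the half-lines converge except possibly at the
  single point a.\<close>

lemma prim_continuous:
  assumes f: "integrable lborel f"
  shows "continuous_on UNIV (prim f)"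
proof (rule continuous_on_sequentiallyI)
  fix u :: "nat \<Rightarrow> real" and a assume u: "u \<longlonglongrightarrow> a"
  note [measurable] = borel_measurable_integrable[OF f]
  show "(\<lambda>n. prim f (u n)) \<longlonglongrightarrow> prim f a"
    unfolding prim_def
  proof (rule integral_dominated_convergence[where w = "\<lambda>x. \<bar>f x\<bar>"])
    have "AE x in lborel. x \<noteq> a" by (rule AE_lborel_singleton)
    then show "AE x in lborel. (\<lambda>i. indicator {..<u i} x * f x) \<longlonglongrightarrow> indicator {..<a} x * f x"
    proof eventually_elim
      case (elim x)
      have "\<forall>\<^sub>F i in sequentially. indicator {..<u i} x * f x = indicator {..<a} x * f x"
      proof (cases "x < a")
        case True
        from order_tendstoD(1)[OF u True] show ?thesis
          by eventually_elim (use True in \<open>auto simp: indicator_def\<close>)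
      next
        case False
        with elim have "a < x" by simp
        from order_tendstoD(2)[OF u this] show ?thesis
          by eventually_elim (use \<open>a < x\<close> in \<open>auto simp: indicator_def\<close>)
      qed
      then show ?case by (rule tendsto_eventually)
    qed
  qed (use f in \<open>auto simp: indicator_def\<close>)
qed

text \<open>Dynkin's argument. The Borel sets over which h integrates to 0 contain the half-lines,
  an intersection-stable generator; they are closed under complements, by the hypothesis on the
  total integral, and under countable disjoint unions.\<close>

lemma integrable_AE_zeroI:
  fixes h :: "real \<Rightarrow> real"
  assumes h: "integrable lborel h" and 0: "\<And>a. prim h a = 0" and tot: "(\<integral>x. h x \<partial>lborel) = 0"
  shows "AE x in lborel. h x = 0"
proof (rule sigma_finite_measure.density_zero[OF sigma_finite_lborel h])
  have sets: "sets lborel = sigma_sets UNIV (range (lessThan :: real \<Rightarrow> _))"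
    by (simp add: borel_eq_lessThan eucl_less_def lessThan_def)
  let ?P = "\<lambda>A. set_lebesgue_integral lborel A h = 0"
  fix B :: "real set" assume "B \<in> sets lborel"
  then have B: "B \<in> sigma_sets UNIV (range lessThan)"
    by (simp only: sets)
  show "?P B"
  proof (rule sigma_sets_induct_disjoint[where P = ?P, OF _ _ B])
    show "Int_stable (range (lessThan :: real \<Rightarrow> _))"
      unfolding Int_stable_def
    proof (intro ballI)
      fix A B :: "real set" assume "A \<in> range lessThan" "B \<in> range lessThan"
      then obtain a b where "A = {..<a}" "B = {..<b}" by blast
      then have "A \<inter> B = {..<min a b}" by auto
      then show "A \<inter> B \<in> range lessThan" by blast
    qed
    show "range lessThan \<subseteq> Pow (UNIV :: real set)" by simp
    show "?P {}" by (simp add: set_lebesgue_integral_def)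
  next
    fix A :: "real set" assume "A \<in> range lessThan"
    then obtain a where "A = {..<a}" by blast
    then show "?P A"
      using 0[of a] by (simp add: set_lebesgue_integral_def prim_def)
  next
    fix A :: "real set" assume "A \<in> sigma_sets UNIV (range lessThan)" and A: "?P A"
    then have m: "A \<in> sets borel" using sets by simp
    have "set_lebesgue_integral lborel (UNIV - A) h = (\<integral>x. h x - indicator A x * h x \<partial>lborel)"
      unfolding set_lebesgue_integral_def
      by (intro Bochner_Integration.integral_cong) (auto simp: indicator_def)
    also have "\<dots> = (\<integral>x. h x \<partial>lborel) - (\<integral>x. indicator A x * h x \<partial>lborel)"
      by (rule Bochner_Integration.integral_diff[OF h integrable_indicator_mult[OF h m]])
    also have "\<dots> = 0"
      using A tot by (simp add: set_lebesgue_integral_def)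
    finally show "?P (UNIV - A)" .
  next
    fix A :: "nat \<Rightarrow> real set" assume d: "disjoint_family A" and "range A \<subseteq> sigma_sets UNIV (range lessThan)"
      and z: "\<And>i. ?P (A i)"
    then have m: "A i \<in> sets borel" for i
      using sets by auto
    have "set_lebesgue_integral lborel (\<Union>i. A i) h = (\<Sum>i. set_lebesgue_integral lborel (A i) h)"
    proof (rule lebesgue_integral_countable_add)
      show "A i \<inter> A j = {}" if "i \<noteq> j" for i j
        using d that by (simp add: disjoint_family_on_def)
      have "(\<Union>i. A i) \<in> sets borel" using m by (intro sets.countable_UN) auto
      then show "set_integrable lborel (\<Union>i. A i) h"
        using integrable_indicator_mult[OF h] by (simp add: set_integrable_def)
    qed (use m in simp)
    then show "?P (\<Union>i. A i)" by (simp add: z)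
  qed
qed

subsection \<open>Laplace transforms of functions on a bounded interval\<close>

text \<open>Borel representatives of \<open>L\<^sup>1(0,T)\<close>: the product measure theorems are available for \<open>lborel\<close>,
  not for its completion.\<close>

definition L1b :: "real \<Rightarrow> (real \<Rightarrow> real) set" where
  "L1b T = {f. integrable lborel f \<and> (\<forall>x. x \<notin> {0<..<T} \<longrightarrow> f x = 0)}"

definition restr :: "real \<Rightarrow> (real \<Rightarrow> real) \<Rightarrow> real \<Rightarrow> real" where
  "restr T f x = indicator {0<..<T} x * f x"

definition laplace :: "(real \<Rightarrow> real) \<Rightarrow> real \<Rightarrow> real" where
  "laplace f s = (\<integral>x. exp (- (s * x)) * f x \<partial>lborel)"

text \<open>The Landau symbol refers to s tending to infinity. Rates strictly below T leave room to
  absorb polynomial factors, as in \<open>negl_mult\<close>, and taken together they still force a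
  function on (0,T) to vanish.\<close>

definition negl :: "real \<Rightarrow> (real \<Rightarrow> real) \<Rightarrow> bool" where
  "negl T F \<longleftrightarrow> (\<forall>\<rho><T. F \<in> O(\<lambda>s. exp (- (\<rho> * s))))"

lemma L1bD: "f \<in> L1b T \<Longrightarrow> integrable lborel f" "f \<in> L1b T \<Longrightarrow> f \<in> borel_measurable borel"
  "f \<in> L1b T \<Longrightarrow> x \<notin> {0<..<T} \<Longrightarrow> f x = 0"
  by (auto simp: L1b_def)

lemma restr_L1b: "integrable lborel f \<Longrightarrow> restr T f \<in> L1b T"
  unfolding L1b_def restr_def using integrable_indicator_mult[of f "{0<..<T}"] by auto

lemma L1b_zero: "(\<lambda>_. 0) \<in> L1b T"
  by (simp add: L1b_def)

lemma L1b_add: "f \<in> L1b T \<Longrightarrow> g \<in> L1b T \<Longrightarrow> (\<lambda>x. f x + g x) \<in> L1b T"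
  by (simp add: L1b_def)

lemma L1b_diff: "f \<in> L1b T \<Longrightarrow> g \<in> L1b T \<Longrightarrow> (\<lambda>x. f x - g x) \<in> L1b T"
  by (simp add: L1b_def)

lemma L1b_mult: "f \<in> L1b T \<Longrightarrow> (\<lambda>x. c * f x) \<in> L1b T"
  by (simp add: L1b_def)

lemma L1b_zero_prim:
  assumes h: "h \<in> L1b T" and T: "T > 0" and 0: "\<And>a. 0 < a \<Longrightarrow> a < T \<Longrightarrow> prim h a = 0"
  shows "AE x in lborel. h x = 0"
proof -
  have [measurable]: "h \<in> borel_measurable borel" using h by (rule L1bD)
  \<comment> \<open>Continuity carries the hypothesis to the end point T. Beyond T the primitive is
    constant, so the total integral is 0 as well.\<close>
  have "prim h T = 0"
  proof (rule continuous_constant_on_closure[of "{0<..<T}" "prim h" 0 T])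
    show "continuous_on (closure {0<..<T}) (prim h)"
      using prim_continuous[OF L1bD(1)[OF h]] by (rule continuous_on_subset) simp
    show "T \<in> closure {0<..<T}" using T by simp
  qed (use 0 in auto)
  moreover have *: "prim h a = (\<integral>x. h x \<partial>lborel)" if "a \<ge> T" for a
    unfolding prim_def
    by (intro Bochner_Integration.integral_cong) (use that L1bD(3)[OF h] in \<open>auto simp: indicator_def\<close>)
  ultimately have tot: "(\<integral>x. h x \<partial>lborel) = 0" by simp
  have neg: "prim h a = 0" if "a \<le> 0" for a
  proof -
    have "prim h a = (\<integral>x. 0 \<partial>(lborel :: real measure))"
      unfolding prim_def
      by (intro Bochner_Integration.integral_cong) (use that L1bD(3)[OF h] in \<open>auto simp: indicator_def\<close>)
    then show ?thesis by simp
  qed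
  have "prim h a = 0" for a
    using 0[of a] neg[of a] *[of a] tot by linarith
  then show ?thesis by (rule integrable_AE_zeroI[OF L1bD(1)[OF h] _ tot])
qed

lemma prim_diff:
  assumes "integrable lborel f" "integrable lborel g"
  shows "prim (\<lambda>x. f x - g x) t = prim f t - prim g t"
  unfolding prim_def right_diff_distrib
  by (intro Bochner_Integration.integral_diff integrable_indicator_mult assms) auto

text \<open>The set of agreement is closed, and a closed set containing almost every point of an
  open set contains all of it.\<close>

lemma AE_continuous_eq:
  fixes f g :: "real \<Rightarrow> real"
  assumes "continuous_on UNIV f" "continuous_on UNIV g"
    and "AE x in lborel. x \<in> {0<..<T} \<longrightarrow> f x = g x" and "x \<in> {0<..<T}"
  shows "f x = g x"
proof -
  have "x \<in> {x. f x = g x}"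
  proof (rule mem_closed_if_AE_lebesgue_open[where S = "{0<..<T}"])
    show "closed {x. f x = g x}" using assms by (intro closed_Collect_eq)
    show "AE x\<in>{0<..<T} in lebesgue. x \<in> {x. f x = g x}"
      using AE_completion[OF assms(3)] by simp
  qed (use assms in auto)
  then show ?thesis by simp
qed

lemma prim_inj:
  assumes f: "f \<in> L1b T" and g: "g \<in> L1b T" and T: "T > 0"
    and eq: "AE x in lborel. x \<in> {0<..<T} \<longrightarrow> prim f x = prim g x"
  shows "AE x in lborel. f x = g x"
proof -
  note i = L1bD(1)[OF f] L1bD(1)[OF g]
  have "prim f x = prim g x" if "0 < x" "x < T" for x
    by (rule AE_continuous_eq[OF prim_continuous prim_continuous eq]) (use i that in auto)
  then have "AE x in lborel. f x - g x = 0"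
    by (intro L1b_zero_prim[OF L1b_diff[OF f g] T]) (simp add: prim_diff[OF i])
  then show ?thesis by simp
qed

text \<open>The exponential is unbounded on the negative half-line. Cut off to (0,T) it is at most 1
  for s \<ge> 0, so the lemmas on bounded multipliers apply, and the cut-off changes no product with
  f.\<close>

lemma integrable_laplace:
  assumes f: "f \<in> L1b T" and s: "s \<ge> 0"
  shows "integrable lborel (\<lambda>x. exp (- (s * x)) * f x)"
    and "\<bar>laplace f s\<bar> \<le> norm1 f"
    and laplace_alt: "laplace f s = (\<integral>x. (indicator {0<..<T} x * exp (- (s * x))) * f x \<partial>lborel)"
proof -
  let ?\<phi> = "\<lambda>x. indicator {0<..<T} x * exp (- (s * x))"
  have b: "\<bar>?\<phi> x\<bar> \<le> 1" for x using s by (auto simp: indicator_def)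
  have m: "?\<phi> \<in> borel_measurable borel" by measurable
  have eq: "(\<lambda>x. ?\<phi> x * f x) = (\<lambda>x. exp (- (s * x)) * f x)"
    using L1bD(3)[OF f] by (intro ext) (auto simp: indicator_def)
  show "integrable lborel (\<lambda>x. exp (- (s * x)) * f x)"
    using integrable_bounded_mult[OF L1bD(1)[OF f] m b] by (simp only: eq)
  show "\<bar>laplace f s\<bar> \<le> norm1 f"
    using abs_integral_le_norm1[OF L1bD(1)[OF f] m b] by (simp only: eq laplace_def mult_1)
  show "laplace f s = (\<integral>x. ?\<phi> x * f x \<partial>lborel)" by (simp only: eq laplace_def)
qed

text \<open>The product of the transforms is an integral over the square with side (0,T). The part
  with x + y < T is the transform of the truncated convolution; on the rest the exponential is at
  most exp (- s T).\<close>

lemma laplace_conv: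
  assumes f: "f \<in> L1b T" and g: "g \<in> L1b T" and s: "s \<ge> 0"
  shows "\<bar>laplace f s * laplace g s - laplace (restr T (conv f g)) s\<bar> \<le> exp (- (s * T)) * norm1 f * norm1 g"
proof -
  note fi = L1bD(1)[OF f] and gi = L1bD(1)[OF g]
  note [measurable] = L1bD(2)[OF f] L1bD(2)[OF g]
  define \<phi> where "\<phi> = (\<lambda>x. indicator {0<..<T} x * exp (- (s * x)))"
  \<comment> \<open>The exponential on the corner x + y \<ge> T of the square, the part that the
    truncated weight \<phi> (x + y) misses.\<close>
  define K where "K = (\<lambda>(y::real) (x::real). indicator {0<..<T} x * indicator {0<..<T} y * indicator {T..} (x + y) * exp (- (s * (x + y))))"
  have [measurable]: "\<phi> \<in> borel_measurable borel" unfolding \<phi>_def by measurable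
  have [measurable]: "case_prod K \<in> borel_measurable borel"
    unfolding K_def borel_prod[symmetric] by measurable
  have \<phi>1: "\<bar>\<phi> x\<bar> \<le> 1" for x using s by (auto simp: indicator_def \<phi>_def)
  have K1: "\<bar>K y x\<bar> \<le> exp (- (s * T))" for x y
    using s mult_left_mono[of T "x + y" s] by (auto simp: indicator_def K_def)
  have split: "\<phi> y * (\<phi> x * f x) * g y = \<phi> (x + y) * f x * g y + K y x * f x * g y" for x y
    using L1bD(3)[OF f, of x] L1bD(3)[OF g, of y]
    by (auto simp: \<phi>_def K_def indicator_def algebra_simps simp flip: exp_add)
  define P where "P = (\<lambda>y. \<integral>x. \<phi> (x + y) * f x \<partial>lborel)"
  define D where "D = (\<lambda>y. \<integral>x. K y x * f x \<partial>lborel)"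
  have [measurable]: "D \<in> borel_measurable borel"
    unfolding D_def K_def by measurable
  have D1: "\<bar>D y\<bar> \<le> exp (- (s * T)) * norm1 f" for y
    unfolding D_def by (rule abs_integral_le_norm1[OF fi _ K1]) (simp add: K_def)
  have y: "\<phi> y * laplace f s * g y = P y * g y + D y * g y" for y
  proof -
    have i1: "integrable lborel (\<lambda>x. \<phi> (x + y) * f x)"
      by (rule integrable_bounded_mult[OF fi _ \<phi>1]) simp
    have i2: "integrable lborel (\<lambda>x. K y x * f x)"
      by (rule integrable_bounded_mult[OF fi _ K1]) (simp add: K_def)
    have "laplace f s = (\<integral>x. \<phi> x * f x \<partial>lborel)"
      by (simp only: laplace_alt[OF f s] \<phi>_def)
    then have "\<phi> y * laplace f s * g y = (\<integral>x. \<phi> y * (\<phi> x * f x) * g y \<partial>lborel)"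
      by simp
    also have "\<dots> = (\<integral>x. \<phi> (x + y) * f x * g y + K y x * f x * g y \<partial>lborel)"
      by (simp only: split)
    also have "\<dots> = P y * g y + D y * g y"
      unfolding P_def D_def using i1 i2 by simp
    finally show ?thesis .
  qed
  have iP: "integrable lborel (\<lambda>y. P y * g y)"
    unfolding P_def by (rule integral_conv(2)[OF fi gi _ \<phi>1]) simp
  have iD: "integrable lborel (\<lambda>y. D y * g y)"
    by (rule integrable_bounded_mult[OF gi _ D1]) simp
  have "laplace g s = (\<integral>y. \<phi> y * g y \<partial>lborel)"
    by (simp only: laplace_alt[OF g s] \<phi>_def)
  then have "laplace f s * laplace g s = (\<integral>y. laplace f s * (\<phi> y * g y) \<partial>lborel)"
    by simp
  also have "\<dots> = (\<integral>y. \<phi> y * laplace f s * g y \<partial>lborel)"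
    by (simp only: mult_ac)
  also have "\<dots> = (\<integral>y. P y * g y \<partial>lborel) + (\<integral>y. D y * g y \<partial>lborel)"
    by (simp only: y) (rule Bochner_Integration.integral_add[OF iP iD])
  also have "(\<integral>y. P y * g y \<partial>lborel) = (\<integral>t. \<phi> t * conv f g t \<partial>lborel)"
    unfolding P_def by (rule integral_conv(1)[OF fi gi _ \<phi>1, symmetric]) simp
  also have "\<dots> = laplace (restr T (conv f g)) s"
    by (simp add: laplace_def restr_def \<phi>_def mult_ac)
  finally have "laplace f s * laplace g s - laplace (restr T (conv f g)) s = (\<integral>y. D y * g y \<partial>lborel)"
    by simp
  also have "\<bar>\<dots>\<bar> \<le> exp (- (s * T)) * norm1 f * norm1 g"
    by (rule abs_integral_le_norm1[OF gi _ D1]) simp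
  finally show ?thesis .
qed

lemma laplace_diff:
  assumes "f \<in> L1b T" "g \<in> L1b T" "s \<ge> 0"
  shows "laplace (\<lambda>x. f x - g x) s = laplace f s - laplace g s"
  unfolding laplace_def right_diff_distrib
  by (intro Bochner_Integration.integral_diff integrable_laplace(1)[OF assms(1,3)] integrable_laplace(1)[OF assms(2,3)])

lemma laplace_AE_cong:
  assumes "AE x in lborel. g x = g' x" and [measurable]: "g \<in> borel_measurable borel" "g' \<in> borel_measurable borel"
  shows "laplace g = laplace g'"
proof
  fix t show "laplace g t = laplace g' t"
    unfolding laplace_def
    by (rule integral_cong_AE) (use assms(1) in \<open>auto elim: eventually_mono\<close>)
qed

lemma sum_exp_le:
  fixes q :: real assumes "q \<ge> 0" shows "(\<Sum>k<m. q ^ k / fact k) \<le> exp q"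
proof -
  have sm: "(\<lambda>k. q ^ k / fact k) sums exp q"
    using exp_converges[of q] by (simp add: divide_inverse mult.commute)
  have "(\<Sum>k<m. q ^ k / fact k) \<le> (\<Sum>k. q ^ k / fact k)"
    using assms by (intro sum_le_suminf sums_summable[OF sm]) auto
  then show ?thesis using sums_unique[OF sm] by simp
qed

text \<open>Mikusinski's argument: the functions \<open>1 - exp (- exp (n (a - x)))\<close> tend to the indicator of
  \<open>{..<a}\<close>, and their power series reduces the integral against \<open>h\<close> to values of the transform
  at the multiples of \<open>n\<close>.\<close>

lemma laplace_negl_imp_zero:
  assumes h: "h \<in> L1b T" and T: "T > 0" and n: "negl T (laplace h)"
  shows "AE x in lborel. h x = 0"
proof (rule L1b_zero_prim[OF h T])
  fix a :: real assume a: "0 < a" "a < T"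
  note hi = L1bD(1)[OF h]
  note [measurable] = L1bD(2)[OF h]
  \<comment> \<open>A decay rate strictly between a and T: below T the hypothesis supplies it, and
    above a it beats the growth exp (n a) in the functions \<open>z n\<close>.\<close>
  define \<rho> where "\<rho> = (a + T) / 2"
  have \<rho>: "\<rho> < T" "a < \<rho>" using a by (auto simp: \<rho>_def)
  from n \<rho> have "laplace h \<in> O(\<lambda>s. exp (- (\<rho> * s)))" by (auto simp: negl_def)
  then obtain C where "C > 0" and ev: "\<forall>\<^sub>F s in at_top. norm (laplace h s) \<le> C * norm (exp (- (\<rho> * s)))"
    by (rule landau_o.bigE)
  then obtain S where S: "\<And>s. s \<ge> S \<Longrightarrow> \<bar>laplace h s\<bar> \<le> C * exp (- (\<rho> * s))"
    by (auto simp: eventually_at_top_linorder)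
  define z where "z = (\<lambda>(n::nat) x. exp (real n * (a - x)))"
  define F where "F = (\<lambda>n. \<integral>x. (1 - exp (- z n x)) * h x \<partial>lborel)"
  have [measurable]: "z n \<in> borel_measurable borel" for n unfolding z_def by measurable
  have "F \<longlonglongrightarrow> prim h a"
    unfolding F_def prim_def
  proof (rule integral_dominated_convergence[where w = "\<lambda>x. \<bar>h x\<bar>"])
    have "AE x in lborel. x \<noteq> a" by (rule AE_lborel_singleton)
    then show "AE x in lborel. (\<lambda>i. (1 - exp (- z i x)) * h x) \<longlonglongrightarrow> indicator {..<a} x * h x"
    proof eventually_elim
      case (elim x)
      show ?case
      proof (rule tendsto_mult_right)
        show "(\<lambda>i. 1 - exp (- z i x)) \<longlonglongrightarrow> indicator {..<a} x"
        proof (cases "x < a")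
          case True
          define d where "d = a - x"
          have "d > 0" using True by (simp add: d_def)
          then have "(\<lambda>i. 1 - exp (- exp (real i * d))) \<longlonglongrightarrow> 1" by real_asymp
          then show ?thesis using True by (simp add: z_def d_def)
        next
          case False
          define d where "d = x - a"
          have "d > 0" using False elim by (simp add: d_def)
          then have "(\<lambda>i. 1 - exp (- exp (- (real i * d)))) \<longlonglongrightarrow> 0" by real_asymp
          then show ?thesis using False by (simp add: z_def d_def algebra_simps)
        qed
      qed
    qed
    fix n show "AE x in lborel. norm ((1 - exp (- z n x)) * h x) \<le> \<bar>h x\<bar>"
      by (intro always_eventually allI) (auto simp: abs_mult z_def intro!: mult_left_le_one_le)
  qed (use hi in auto)
  moreover have "F \<longlonglongrightarrow> 0"
  proof (rule tendsto_0_le[where K = 1])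
    show "(\<lambda>n. C * (exp (exp (- (real n * (\<rho> - a)))) - 1)) \<longlonglongrightarrow> 0"
    proof -
      define d where "d = \<rho> - a"
      have "d > 0" using \<rho> by (simp add: d_def)
      then show ?thesis unfolding d_def[symmetric] by real_asymp
    qed
    show "\<forall>\<^sub>F n in sequentially. norm (F n) \<le> norm (C * (exp (exp (- (real n * (\<rho> - a)))) - 1)) * 1"
      using eventually_ge_at_top[of "nat \<lceil>max S 1\<rceil>"]
    proof eventually_elim
      case (elim n)
      then have n: "real n \<ge> S" "real n \<ge> 1" by linarith+
      \<comment> \<open>The growth exp (k n a) of the k-th coefficient and the decay exp (- \<rho> k
        n) of the transform combine to q to the power k. Summing over k \<ge> 1 gives C (exp q - 1),
        which tends to 0 with q as n grows.\<close>
      define q where "q = exp (- (real n * (\<rho> - a)))"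
      \<comment> \<open>For fixed n the exponential series may be integrated term by term: on the
        support of h one has x > 0, hence \<open>z n x\<close> is at most exp (n a), which bounds
        all partial sums at once.\<close>
      have "(\<lambda>m. \<integral>x. (1 - (\<Sum>k<m. (- z n x) ^ k / fact k)) * h x \<partial>lborel) \<longlonglongrightarrow> F n"
        unfolding F_def
      proof (rule integral_dominated_convergence[where w = "\<lambda>x. (1 + exp (exp (real n * a))) * \<bar>h x\<bar>"])
        show "AE x in lborel. (\<lambda>m. (1 - (\<Sum>k<m. (- z n x) ^ k / fact k)) * h x) \<longlonglongrightarrow> (1 - exp (- z n x)) * h x"
        proof (intro always_eventually allI tendsto_mult_right tendsto_diff tendsto_const)
          fix x
          have "(\<lambda>k. (- z n x) ^ k / fact k) sums exp (- z n x)"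
            using exp_converges[of "- z n x"] by (simp add: divide_inverse mult.commute)
          then show "(\<lambda>m. \<Sum>k<m. (- z n x) ^ k / fact k) \<longlonglongrightarrow> exp (- z n x)" by (simp add: sums_def)
        qed
        fix m
        show "AE x in lborel. norm ((1 - (\<Sum>k<m. (- z n x) ^ k / fact k)) * h x) \<le> (1 + exp (exp (real n * a))) * \<bar>h x\<bar>"
        proof (intro always_eventually allI)
          fix x
          show "norm ((1 - (\<Sum>k<m. (- z n x) ^ k / fact k)) * h x) \<le> (1 + exp (exp (real n * a))) * \<bar>h x\<bar>"
          proof (cases "x \<in> {0<..<T}")
            case True
            have "\<bar>\<Sum>k<m. (- z n x) ^ k / fact k\<bar> \<le> (\<Sum>k<m. z n x ^ k / fact k)"
              by (rule order_trans[OF sum_abs]) (simp add: power_abs z_def)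
            also have "\<dots> \<le> exp (z n x)" by (rule sum_exp_le) (simp add: z_def)
            also have "\<dots> \<le> exp (exp (real n * a))" using True by (simp add: z_def mult_left_mono)
            finally have "\<bar>1 - (\<Sum>k<m. (- z n x) ^ k / fact k)\<bar> \<le> 1 + exp (exp (real n * a))" by linarith
            then show ?thesis by (simp add: abs_mult mult_right_mono)
          qed (use L1bD(3)[OF h] in auto)
        qed
      qed (use hi in auto)
      moreover have "\<forall>\<^sub>F m in sequentially. \<bar>\<integral>x. (1 - (\<Sum>k<m. (- z n x) ^ k / fact k)) * h x \<partial>lborel\<bar> \<le> C * (exp q - 1)"
        using eventually_ge_at_top[of 1]
      proof eventually_elim
        case (elim m)
        \<comment> \<open>The term k = 0 cancels the 1. What remains are values of the transform at
          k n with k \<ge> 1, all beyond the threshold S.\<close>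
        define c where "c = (\<lambda>k. - ((-1) ^ k * exp (real (k * n) * a) / fact k :: real))"
        have "{..<m} = insert 0 {1..<m}" using elim by auto
        then have sm: "(\<Sum>k<m. f k) = f 0 + (\<Sum>k=1..<m. f k)" for f :: "nat \<Rightarrow> real" by simp
        have zk: "(- z n x) ^ k = (-1) ^ k * (exp (real (k * n) * a) * exp (- (real (k * n) * x)))" for x k
          by (subst power_minus) (simp add: z_def algebra_simps flip: exp_of_nat_mult exp_add)
        have "(1 - (\<Sum>k<m. (- z n x) ^ k / fact k)) * h x
          = (\<Sum>k=1..<m. c k * (exp (- (real (k * n) * x)) * h x))" for x
          by (simp add: sm zk c_def sum_distrib_right flip: sum_negf) (simp add: mult_ac)
        then have "(\<integral>x. (1 - (\<Sum>k<m. (- z n x) ^ k / fact k)) * h x \<partial>lborel)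
          = (\<integral>x. (\<Sum>k=1..<m. c k * (exp (- (real (k * n) * x)) * h x)) \<partial>lborel)"
          by (simp only:)
        also have "\<dots> = (\<Sum>k=1..<m. c k * laplace h (real (k * n)))"
          unfolding laplace_def using integrable_laplace(1)[OF h]
          by (subst Bochner_Integration.integral_sum) auto
        also have "\<bar>\<dots>\<bar> \<le> (\<Sum>k=1..<m. C * (q ^ k / fact k))"
        proof (rule order_trans[OF sum_abs sum_mono])
          fix k assume k: "k \<in> {1..<m}"
          then have "real n \<le> real (k * n)" by (intro of_nat_mono) simp
          then have "\<bar>laplace h (real (k * n))\<bar> \<le> C * exp (- (\<rho> * real (k * n)))" using n by (intro S) linarith
          then have "\<bar>c k * laplace h (real (k * n))\<bar>
              \<le> exp (real (k * n) * a) / fact k * (C * exp (- (\<rho> * real (k * n))))"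
            unfolding abs_mult by (intro mult_mono) (auto simp: c_def abs_mult power_abs)
          also have "\<dots> = C * (q ^ k / fact k)"
            by (simp add: q_def algebra_simps flip: exp_of_nat_mult exp_add)
          finally show "\<bar>c k * laplace h (real (k * n))\<bar> \<le> C * (q ^ k / fact k)" .
        qed
        also have "\<dots> = C * ((\<Sum>k<m. q ^ k / fact k) - 1)"
          by (simp add: sm sum_distrib_left)
        also have "\<dots> \<le> C * (exp q - 1)"
          using \<open>C > 0\<close> sum_exp_le[of q m] by (simp add: q_def)
        finally show ?case .
      qed
      ultimately have "\<bar>F n\<bar> \<le> C * (exp q - 1)"
        by (intro tendsto_upperbound[OF tendsto_rabs]) auto
      then show ?case by (simp add: q_def)
    qed
  qed
  ultimately show "prim h a = 0" by (rule LIMSEQ_unique)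
qed

section \<open>Calculus of exponentially small errors\<close>

lemma negl_add: "negl T F \<Longrightarrow> negl T G \<Longrightarrow> negl T (\<lambda>s. F s + G s)"
  unfolding negl_def by (auto intro: sum_in_bigo)

lemma negl_diff: "negl T F \<Longrightarrow> negl T G \<Longrightarrow> negl T (\<lambda>s. F s - G s)"
  unfolding negl_def by (auto intro: sum_in_bigo)

lemma negl_mono:
  assumes "negl T F" "\<forall>\<^sub>F s in at_top. \<bar>G s\<bar> \<le> \<bar>F s\<bar>"
  shows "negl T G"
proof -
  have "G \<in> O(F)" by (rule landau_o.big_mono) (use assms(2) in simp)
  then show ?thesis using assms(1) unfolding negl_def by (blast intro: landau_o.big_trans)
qed

text \<open>Polynomial growth costs an arbitrarily small part of the exponential rate: the bound
  with rate \<sigma>, halfway between \<rho> and T, pays for the factor and leaves rate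
  \<rho>.\<close>

lemma negl_mult:
  assumes "negl T F" "G \<in> O(\<lambda>s. s powr c)"
  shows "negl T (\<lambda>s. F s * G s)"
  unfolding negl_def
proof (intro allI impI)
  fix \<rho> assume "\<rho> < T"
  define \<sigma> where "\<sigma> = (\<rho> + T) / 2"
  have "\<sigma> < T" "\<rho> < \<sigma>" using \<open>\<rho> < T\<close> by (auto simp: \<sigma>_def)
  have "(\<lambda>s. F s * G s) \<in> O(\<lambda>s. exp (- (\<sigma> * s)) * s powr c)"
    using assms \<open>\<sigma> < T\<close> by (intro landau_o.big.mult) (auto simp: negl_def)
  moreover have "(\<lambda>s. exp (- (\<sigma> * s)) * s powr c) \<in> O(\<lambda>s. exp (- (\<rho> * s)))"
  proof -
    define d where "d = \<sigma> - \<rho>"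
    have "d > 0" using \<open>\<rho> < \<sigma>\<close> by (simp add: d_def)
    then have "(\<lambda>s. exp (- (d * s)) * s powr c) \<in> O(\<lambda>s. 1)" by real_asymp
    then have "(\<lambda>s. exp (- (\<rho> * s)) * (exp (- (d * s)) * s powr c)) \<in> O(\<lambda>s. exp (- (\<rho> * s)) * 1)"
      by (intro landau_o.big.mult) auto
    moreover have "exp (- (\<sigma> * s)) * s powr c = exp (- (\<rho> * s)) * (exp (- (d * s)) * s powr c)" for s
      by (simp add: d_def algebra_simps flip: exp_add)
    ultimately show ?thesis by (simp only: mult_1_right)
  qed
  ultimately show "(\<lambda>s. F s * G s) \<in> O(\<lambda>s. exp (- (\<rho> * s)))" by (rule landau_o.big_trans)
qed

lemma negl_exp: "negl T (\<lambda>s. exp (- (s * T)))"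
  unfolding negl_def
proof (intro allI impI)
  fix \<rho> assume "\<rho> < T"
  then show "(\<lambda>s. exp (- (s * T))) \<in> O(\<lambda>s. exp (- (\<rho> * s)))"
    by (intro landau_o.big_mono eventually_mono[OF eventually_ge_at_top[of 0]]) (simp add: mult.commute mult_left_mono)
qed

lemma negl_cmult: "negl T F \<Longrightarrow> negl T (\<lambda>s. c * F s)"
  unfolding negl_def by (cases "c = 0") auto

lemma negl_bound:
  assumes "\<And>s. s \<ge> 1 \<Longrightarrow> \<bar>F s\<bar> \<le> exp (- (s * T)) * C"
  shows "negl T F"
proof (rule negl_mono[OF negl_cmult[OF negl_exp, where c = C]])
  show "\<forall>\<^sub>F s in at_top. \<bar>F s\<bar> \<le> \<bar>C * exp (- (s * T))\<bar>"
    using eventually_ge_at_top[of 1]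
  proof eventually_elim
    case (elim s)
    then show ?case using assms[of s] by (simp add: mult.commute)
  qed
qed

text \<open>Stable extraction of roots: in the factorisation of the difference of powers the
  cofactor is a sum of nonnegative terms, hence at least its term of index 0, which is y to the
  power q.\<close>

lemma diff_mult_power_le_diff_power:
  fixes z y :: real
  assumes "z \<ge> 0" "y \<ge> 0"
  shows "\<bar>z - y\<bar> * y ^ q \<le> \<bar>z ^ Suc q - y ^ Suc q\<bar>"
proof -
  have "y ^ q \<le> (\<Sum>p<Suc q. z ^ p * y ^ (q - p))"
    using assms member_le_sum[of 0 "{..<Suc q}" "\<lambda>p. z ^ p * y ^ (q - p)"] by simp
  then have "\<bar>z - y\<bar> * y ^ q \<le> \<bar>z - y\<bar> * \<bar>\<Sum>p<Suc q. z ^ p * y ^ (q - p)\<bar>"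
    by (intro mult_left_mono) auto
  also have "\<dots> = \<bar>z ^ Suc q - y ^ Suc q\<bar>"
    by (simp only: diff_power_eq_sum abs_mult)
  finally show ?thesis .
qed

section \<open>Power functions and their transforms\<close>

text \<open>The expected value of \<open>J \<alpha>\<close> at the constant 1. With \<alpha> - 1 in
  place of \<alpha> it is the Riemann-Liouville kernel of order \<alpha>.\<close>

definition pw :: "real \<Rightarrow> real \<Rightarrow> real \<Rightarrow> real" where
  "pw T \<alpha> = restr T (\<lambda>x. x powr \<alpha> / Gamma (\<alpha> + 1))"

lemma has_bochner_integral_powr:
  fixes \<alpha> t :: real
  assumes "\<alpha> > -1" "t \<ge> 0"
  shows "has_bochner_integral lborel (\<lambda>x. indicator {0..t} x * x powr \<alpha>) (t powr (\<alpha> + 1) / (\<alpha> + 1))"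
  by (rule has_bochner_integral_nn_integral)
    (use assms nn_integral_has_integral_lebesgue[OF _ has_integral_powr_from_0[OF assms]] in auto)

lemma pw_L1b:
  assumes "\<alpha> > -1" "T > 0" shows "pw T \<alpha> \<in> L1b T"
proof -
  have "integrable lborel (\<lambda>x. indicator {0..T} x * x powr \<alpha>)"
    using has_bochner_integral_powr[of \<alpha> T] assms by (auto simp: has_bochner_integral_iff)
  then have "restr T (\<lambda>x. (indicator {0..T} x * x powr \<alpha>) / Gamma (\<alpha> + 1)) \<in> L1b T"
    by (intro restr_L1b) simp
  also have "restr T (\<lambda>x. (indicator {0..T} x * x powr \<alpha>) / Gamma (\<alpha> + 1)) = pw T \<alpha>"
    by (auto simp: pw_def restr_def indicator_def)
  finally show ?thesis .
qed

lemma prim_pw: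
  assumes \<alpha>: "\<alpha> > -1" and t: "0 < t" "t \<le> T"
  shows "prim (pw T \<alpha>) t = t powr (\<alpha> + 1) / Gamma (\<alpha> + 2)"
proof -
  have "prim (pw T \<alpha>) t = (\<integral>x. (indicator {0..t} x * x powr \<alpha>) / Gamma (\<alpha> + 1) \<partial>lborel)"
    unfolding prim_def
  proof (rule integral_cong_AE)
    have "AE x in lborel. x \<noteq> 0" "AE x in lborel. x \<noteq> t" by (rule AE_lborel_singleton)+
    then show "AE x in lborel. indicator {..<t} x * pw T \<alpha> x = (indicator {0..t} x * x powr \<alpha>) / Gamma (\<alpha> + 1)"
      by eventually_elim (use t in \<open>auto simp: pw_def restr_def indicator_def\<close>)
  qed (use L1bD(2)[OF pw_L1b, of \<alpha> T] \<alpha> t in auto)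
  also have "\<dots> = t powr (\<alpha> + 1) / ((\<alpha> + 1) * Gamma (\<alpha> + 1))"
    using has_bochner_integral_powr[of \<alpha> t] assms by (auto simp: has_bochner_integral_iff)
  also have "(\<alpha> + 1) * Gamma (\<alpha> + 1) = Gamma (\<alpha> + 2)"
    using Gamma_plus1[of "\<alpha> + 1"] \<alpha> nonpos_Ints_nonpos[of "\<alpha> + 1"] by (force simp: add_ac)
  finally show ?thesis .
qed

text \<open>Euler's integral is the case s = 1; the substitution of s x for x gives the
  rest.\<close>

lemma has_bochner_integral_Gamma:
  fixes \<alpha> s :: real
  assumes \<alpha>: "\<alpha> > -1" and s: "s > 0"
  shows "has_bochner_integral lborel (\<lambda>x. indicator {0..} x * (x powr \<alpha> * exp (- (s * x))))
    (Gamma (\<alpha> + 1) * s powr (- (\<alpha> + 1)))"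
proof -
  have "((\<lambda>t. t powr \<alpha> * exp (- t)) has_integral Gamma (\<alpha> + 1)) {0..}"
    using Gamma_integral_real[of "\<alpha> + 1"] \<alpha> by (simp add: exp_minus divide_inverse)
  then have "has_bochner_integral lborel (\<lambda>x. indicator {0..} x * (x powr \<alpha> * exp (- x))) (Gamma (\<alpha> + 1))"
    using \<alpha> nn_integral_has_integral_lebesgue[of "{0..}" "\<lambda>t. t powr \<alpha> * exp (- t)" "Gamma (\<alpha> + 1)"]
    by (intro has_bochner_integral_nn_integral) (auto intro!: Gamma_real_nonneg)
  then have "has_bochner_integral lborel (\<lambda>x. indicator {0..} (0 + s * x) * ((0 + s * x) powr \<alpha> * exp (- (0 + s * x))))
     (Gamma (\<alpha> + 1) /\<^sub>R \<bar>s\<bar>)"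
    using s by (subst (asm) lborel_has_bochner_integral_real_affine_iff[of s _ _ 0]) auto
  then have "has_bochner_integral lborel (\<lambda>x. s powr (- \<alpha>) * (indicator {0..} (0 + s * x) * ((0 + s * x) powr \<alpha> * exp (- (0 + s * x)))))
     (s powr (- \<alpha>) * (Gamma (\<alpha> + 1) /\<^sub>R \<bar>s\<bar>))"
    by (rule has_bochner_integral_mult_right)
  also have "s powr (- \<alpha>) * (Gamma (\<alpha> + 1) /\<^sub>R \<bar>s\<bar>) = Gamma (\<alpha> + 1) * s powr (- (\<alpha> + 1))"
    using s powr_diff[of s "- \<alpha>" 1] by (simp add: divide_inverse)
  also have "(\<lambda>x. s powr (- \<alpha>) * (indicator {0..} (0 + s * x) * ((0 + s * x) powr \<alpha> * exp (- (0 + s * x)))))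
     = (\<lambda>x. indicator {0..} x * (x powr \<alpha> * exp (- (s * x))))"
    using s by (intro ext) (auto simp: indicator_def powr_mult powr_minus zero_le_mult_iff field_simps)
  finally show ?thesis .
qed

text \<open>The error is the tail of the Gamma integral over x \<ge> T. There s \<ge> 1 gives exp (-
  s x) \<le> exp (- (s - 1) T) exp (- x), and the normalised integral of the power against exp (- x)
  is 1.\<close>

lemma laplace_pw:
  assumes \<alpha>: "\<alpha> > -1" and T: "T > 0"
  shows "negl T (\<lambda>s. laplace (pw T \<alpha>) s - s powr (- (\<alpha> + 1)))"
proof (rule negl_bound)
  fix s :: real assume s: "s \<ge> 1"
  define G where "G = Gamma (\<alpha> + 1)"
  have G: "G > 0" using \<alpha> by (simp add: G_def Gamma_real_pos)
  define w where "w = (\<lambda>s x. indicator {0..} x * (x powr \<alpha> * exp (- (s * x))) :: real)"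
  have w: "integrable lborel (w s)" "(\<integral>x. w s x \<partial>lborel) = G * s powr (- (\<alpha> + 1))" if "s > 0" for s
    using has_bochner_integral_Gamma[OF \<alpha> that] by (auto simp: has_bochner_integral_iff w_def G_def)
  note il = integrable_laplace(1)[OF pw_L1b[OF \<alpha> T], of s]
  have "s powr (- (\<alpha> + 1)) - laplace (pw T \<alpha>) s = (\<integral>x. w s x / G - exp (- (s * x)) * pw T \<alpha> x \<partial>lborel)"
    unfolding laplace_def
    by (subst Bochner_Integration.integral_diff) (use w[of s] il G s in auto)
  also have "\<bar>\<dots>\<bar> \<le> (\<integral>x. \<bar>w s x / G - exp (- (s * x)) * pw T \<alpha> x\<bar> \<partial>lborel)"
    by (rule integral_abs_bound)
  also have "\<dots> \<le> (\<integral>x. exp (- ((s - 1) * T)) * (w 1 x / G) \<partial>lborel)"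
  proof (rule integral_mono_AE)
    have "AE x in lborel. x \<noteq> 0" by (rule AE_lborel_singleton)
    then show "AE x in lborel. \<bar>w s x / G - exp (- (s * x)) * pw T \<alpha> x\<bar> \<le> exp (- ((s - 1) * T)) * (w 1 x / G)"
    proof eventually_elim
      case (elim x)
      consider "x < 0" | "0 < x" "x < T" | "x \<ge> T" using elim by linarith
      then show ?case
      proof cases
        case 3
        have "exp (- (s * x)) \<le> exp (- ((s - 1) * T)) * exp (- x)"
          using s 3 mult_left_mono[of T x "s - 1"] by (simp add: algebra_simps flip: exp_add)
        then have "x powr \<alpha> * exp (- (s * x)) / G \<le> x powr \<alpha> * (exp (- ((s - 1) * T)) * exp (- x)) / G"
          using G by (intro divide_right_mono mult_left_mono) auto
        then show ?thesis using 3 T G by (simp add: w_def pw_def restr_def indicator_def mult_ac)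
      qed (use G in \<open>auto simp: w_def pw_def restr_def indicator_def G_def\<close>)
    qed
  qed (use w[of s] w[of 1] il s in auto)
  also have "\<dots> = exp (- ((s - 1) * T))"
    using w[of 1] G by simp
  also have "\<dots> = exp (- (s * T)) * exp T"
    by (simp add: algebra_simps flip: exp_add)
  finally show "\<bar>laplace (pw T \<alpha>) s - s powr (- (\<alpha> + 1))\<bar> \<le> exp (- (s * T)) * exp T"
    by (simp only: abs_minus_commute)
qed

subsection \<open>The Volterra operator\<close>

abbreviation ae_eq :: "(real \<Rightarrow> real) \<Rightarrow> (real \<Rightarrow> real) \<Rightarrow> bool" (infix "\<doteq>" 50) where
  "f \<doteq> g \<equiv> AE x in lborel. f x = g x"

lemma ae_eq_trans [trans]: "f \<doteq> g \<Longrightarrow> g \<doteq> h \<Longrightarrow> f \<doteq> h"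
  by (auto elim: eventually_elim2)

lemma ae_eq_sym: "f \<doteq> g \<Longrightarrow> g \<doteq> f"
  by (auto elim: eventually_mono)

definition volterra :: "real \<Rightarrow> (real \<Rightarrow> real) \<Rightarrow> real \<Rightarrow> real" where
  "volterra T f = restr T (prim f)"

lemma abs_prim_le: "integrable lborel f \<Longrightarrow> \<bar>prim f t\<bar> \<le> norm1 f"
  unfolding prim_def using abs_integral_le_norm1[of f "indicator {..<t}" 1] by (simp add: indicator_def)

lemma borel_measurable_prim: "integrable lborel f \<Longrightarrow> prim f \<in> borel_measurable borel"
  by (rule borel_measurable_continuous_onI[OF prim_continuous])

lemma restr_bounded_L1b:
  assumes [measurable]: "F \<in> borel_measurable borel" and b: "\<And>x. x \<in> {0<..<T} \<Longrightarrow> \<bar>F x\<bar> \<le> c" and T: "T > 0"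
  shows "restr T F \<in> L1b T" and "norm1 (restr T F) \<le> T * c"
proof -
  let ?I = "indicator {0<..<T} :: real \<Rightarrow> real"
  have I: "integrable lborel ?I" using T by (intro integrable_real_indicator) auto
  have c: "c \<ge> 0" using b[of "T / 2"] T by auto
  have bd: "\<bar>?I x * F x\<bar> \<le> c" for x using b c by (auto simp: indicator_def)
  have eq: "(\<lambda>x. (?I x * F x) * ?I x) = restr T F"
    by (auto simp: restr_def indicator_def)
  have m: "(\<lambda>x. ?I x * F x) \<in> borel_measurable borel" by measurable
  have int: "integrable lborel (restr T F)"
    using integrable_bounded_mult[OF I m bd] by (simp only: eq)
  then show "restr T F \<in> L1b T" by (auto simp: L1b_def restr_def)
  have "norm1 (restr T F) \<le> (\<integral>x. c * ?I x \<partial>lborel)"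
    unfolding norm1_def
  proof (rule integral_mono)
    show "integrable lborel (\<lambda>x. \<bar>restr T F x\<bar>)" using int by (rule integrable_abs)
    show "integrable lborel (\<lambda>x. c * ?I x)" using I by simp
    fix x show "\<bar>restr T F x\<bar> \<le> c * ?I x"
      using b[of x] by (auto simp: restr_def indicator_def)
  qed
  then show "norm1 (restr T F) \<le> T * c" using T by (simp add: mult.commute)
qed

lemma volterra_L1b: "f \<in> L1b T \<Longrightarrow> T > 0 \<Longrightarrow> volterra T f \<in> L1b T"
  and norm1_volterra: "f \<in> L1b T \<Longrightarrow> T > 0 \<Longrightarrow> norm1 (volterra T f) \<le> T * norm1 f"
  using restr_bounded_L1b[of "prim f" T "norm1 f"]
  by (simp_all add: volterra_def abs_prim_le borel_measurable_prim L1bD(1))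

lemma volterra_cong: "f \<in> L1b T \<Longrightarrow> g \<in> L1b T \<Longrightarrow> f \<doteq> g \<Longrightarrow> volterra T f = volterra T g"
  unfolding volterra_def using prim_AE_cong[of f g] L1bD(2) by auto

lemma volterra_diff: "f \<in> L1b T \<Longrightarrow> g \<in> L1b T \<Longrightarrow> volterra T (\<lambda>x. f x - g x) = (\<lambda>x. volterra T f x - volterra T g x)"
  by (rule ext) (simp add: volterra_def restr_def prim_diff[OF L1bD(1) L1bD(1)] right_diff_distrib)

lemma volterra_lincomb:
  assumes "f \<in> L1b T" "g \<in> L1b T"
  shows "volterra T (\<lambda>x. f x + c * g x) = (\<lambda>x. volterra T f x + c * volterra T g x)"
proof
  fix x
  have "prim (\<lambda>x. f x + c * g x) x = (\<integral>y. indicator {..<x} y * f y + c * (indicator {..<x} y * g y) \<partial>lborel)"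
    unfolding prim_def by (intro Bochner_Integration.integral_cong) (simp_all only: distrib_left mult.left_commute)
  also have "\<dots> = prim f x + c * prim g x"
    unfolding prim_def using integrable_indicator_mult[OF L1bD(1), of _ T "{..<x}"] assms by simp
  finally show "volterra T (\<lambda>x. f x + c * g x) x = volterra T f x + c * volterra T g x"
    by (simp only: volterra_def restr_def distrib_left mult.left_commute)
qed

lemma prim_nonpos: "f \<in> L1b T \<Longrightarrow> t \<le> 0 \<Longrightarrow> prim f t = 0"
proof -
  assume "f \<in> L1b T" "t \<le> 0"
  then have "(\<lambda>x. indicator {..<t} x * f x) = (\<lambda>x. 0)"
    using L1bD(3)[of f T] by (intro ext) (auto simp: indicator_def)
  then show ?thesis by (simp only: prim_def) simp
qed

lemma conv_nonpos:
  assumes "f \<in> L1b T" "g \<in> L1b T" "t \<le> 0" shows "conv f g t = 0"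
proof -
  have "f (t - y) * g y = 0" for y
    using assms L1bD(3)[of f T "t - y"] L1bD(3)[of g T y] by (cases "y \<le> 0") auto
  then show ?thesis by (simp only: conv_def) simp
qed

lemma prim_inj_volterra:
  assumes "f \<in> L1b T" "g \<in> L1b T" "T > 0" "volterra T f \<doteq> volterra T g" shows "f \<doteq> g"
proof (rule prim_inj[OF assms(1-3)])
  show "AE x in lborel. x \<in> {0<..<T} \<longrightarrow> prim f x = prim g x"
    using assms(4) by eventually_elim (auto simp: volterra_def restr_def)
qed

text \<open>Causality: for t in (0,T) only values at arguments below t matter, so truncation to
  (0,T) may be moved in and out, and the identity reduces to \<open>prim_conv\<close>.\<close>

lemma volterra_conv:
  assumes f: "f \<in> L1b T" and g: "g \<in> L1b T"
  shows "volterra T (restr T (conv f g)) = restr T (conv (volterra T f) g)"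
proof
  fix t
  show "volterra T (restr T (conv f g)) t = restr T (conv (volterra T f) g) t"
  proof (cases "t \<in> {0<..<T}")
    case True
    have "prim (restr T (conv f g)) t = prim (conv f g) t"
      unfolding prim_def
    proof (intro Bochner_Integration.integral_cong refl)
      fix y show "indicator {..<t} y * restr T (conv f g) y = indicator {..<t} y * conv f g y"
        using True conv_nonpos[OF f g, of y] by (cases "y \<le> 0") (auto simp: restr_def indicator_def)
    qed
    also have "\<dots> = conv (prim f) g t" by (rule prim_conv[OF L1bD(1)[OF f] L1bD(1)[OF g]])
    also have "\<dots> = conv (volterra T f) g t"
      unfolding conv_def
    proof (intro Bochner_Integration.integral_cong refl)
      fix y show "prim f (t - y) * g y = volterra T f (t - y) * g y"
        using True L1bD(3)[OF g, of y] prim_nonpos[OF f, of "t - y"]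
        by (cases "y \<in> {0<..<T}"; cases "t - y \<le> 0") (auto simp: volterra_def restr_def indicator_def)
    qed
    finally show ?thesis using True by (simp add: volterra_def restr_def)
  qed (simp_all add: volterra_def restr_def)
qed

lemma volterra_eq_conv:
  assumes f: "f \<in> L1b T"
  shows "volterra T f = restr T (conv (restr T (\<lambda>_. 1)) f)"
proof
  fix t
  show "volterra T f t = restr T (conv (restr T (\<lambda>_. 1)) f) t"
  proof (cases "t \<in> {0<..<T}")
    case True
    have "prim f t = conv (restr T (\<lambda>_. 1)) f t"
      unfolding prim_def conv_def
    proof (intro Bochner_Integration.integral_cong refl)
      fix y show "indicator {..<t} y * f y = restr T (\<lambda>_. 1) (t - y) * f y"
        using True L1bD(3)[OF f, of y] by (cases "y \<in> {0<..<T}") (auto simp: restr_def indicator_def)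
    qed
    then show ?thesis by (simp add: volterra_def restr_def)
  qed (simp_all add: volterra_def restr_def)
qed

text \<open>Additivity holds wherever both integrands are integrable, which Fubini guarantees for
  almost every point; elsewhere default values may spoil it.\<close>

lemma conv_lincomb:
  assumes u: "integrable lborel u" and f: "integrable lborel f" and g: "integrable lborel g"
  shows "conv u (\<lambda>x. f x + c * g x) \<doteq> (\<lambda>x. conv u f x + c * conv u g x)"
  using lborel_pair.AE_integrable_fst[OF integrable_conv_pair[OF u f]]
    lborel_pair.AE_integrable_fst[OF integrable_conv_pair[OF u g]]
proof eventually_elim
  case (elim x)
  have "conv u (\<lambda>x. f x + c * g x) x = (\<integral>y. u (x - y) * f y + c * (u (x - y) * g y) \<partial>lborel)"
    unfolding conv_def by (simp only: distrib_left mult.left_commute)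
  also have "\<dots> = conv u f x + c * conv u g x"
    unfolding conv_def using elim by simp
  finally show ?case .
qed

lemma norm1_zero_iff: "integrable lborel f \<Longrightarrow> norm1 f = 0 \<Longrightarrow> f \<doteq> (\<lambda>_. 0)"
  unfolding norm1_def using integral_nonneg_eq_0_iff_AE[of lborel "\<lambda>x. \<bar>f x\<bar>"] by simp

lemma norm1_triangle:
  assumes "integrable lborel f" "integrable lborel g" "integrable lborel h"
  shows "norm1 (\<lambda>x. f x - h x) \<le> norm1 (\<lambda>x. f x - g x) + norm1 (\<lambda>x. g x - h x)"
proof -
  have "norm1 (\<lambda>x. f x - h x) \<le> (\<integral>x. \<bar>f x - g x\<bar> + \<bar>g x - h x\<bar> \<partial>lborel)"
    unfolding norm1_def using assms by (intro integral_mono) auto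
  then show ?thesis unfolding norm1_def using assms by simp
qed

lemma norm1_minus_commute: "norm1 (\<lambda>x. f x - g x) = norm1 (\<lambda>x. g x - f x)"
  by (simp add: norm1_def abs_minus_commute)

lemma norm1_cong: "f \<doteq> g \<Longrightarrow> f \<in> borel_measurable borel \<Longrightarrow> g \<in> borel_measurable borel \<Longrightarrow> norm1 f = norm1 g"
  unfolding norm1_def by (intro integral_cong_AE) (auto elim: eventually_mono)

lemma norm1_restr_le: "integrable lborel f \<Longrightarrow> norm1 (restr T f) \<le> norm1 f"
  unfolding norm1_def
  by (intro integral_mono integrable_abs L1bD(1)[OF restr_L1b]) (auto simp: restr_def indicator_def)

lemma volterra_pw:
  assumes "\<alpha> > -1" "T > 0"
  shows "volterra T (pw T \<alpha>) = pw T (\<alpha> + 1)"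
proof
  fix t show "volterra T (pw T \<alpha>) t = pw T (\<alpha> + 1) t"
    using prim_pw[OF assms(1), of t T] by (cases "t \<in> {0<..<T}") (auto simp: volterra_def pw_def restr_def add_ac)
qed

lemma pw_0: "pw T 0 = restr T (\<lambda>_. 1)"
  by (rule ext) (auto simp: pw_def restr_def indicator_def)

text \<open>Pointwise convergence by continuity of Gamma and of the exponential in the exponent,
  then dominated convergence on the bounded interval.\<close>

lemma pw_tendsto:
  assumes r: "r \<longlonglongrightarrow> \<alpha>" and \<alpha>: "\<alpha> > 0" and T: "T > 0"
  shows "(\<lambda>n. norm1 (\<lambda>x. pw T (r n) x - pw T \<alpha> x)) \<longlonglongrightarrow> 0"
proof -
  have G: "(\<lambda>n. Gamma (r n + 1)) \<longlonglongrightarrow> Gamma (\<alpha> + 1)"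
    using \<alpha> r by (intro tendsto_intros) (auto dest: nonpos_Ints_nonpos)
  have Gp: "Gamma (\<alpha> + 1) > 0" using \<alpha> by (simp add: Gamma_real_pos)
  define c where "c = Gamma (\<alpha> + 1) / 2"
  have c: "c > 0" "c < Gamma (\<alpha> + 1)" using Gp by (auto simp: c_def)
  \<comment> \<open>A bound for all exponents in (0, \<alpha> + 1]: the base 1 + T exceeds 1, so its
    powers grow with the exponent, and c keeps the Gamma factors away from 0. It holds from an index
    N on, hence the shift by N below.\<close>
  define M where "M = (1 + T) powr (\<alpha> + 1) / c"
  have "\<forall>\<^sub>F n in sequentially. r n > 0 \<and> r n < \<alpha> + 1 \<and> Gamma (r n + 1) > c"
    using order_tendstoD(1)[OF r \<alpha>] order_tendstoD(2)[OF r less_add_one] order_tendstoD(1)[OF G c(2)]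
    by eventually_elim auto
  then obtain N where N: "\<And>n. n \<ge> N \<Longrightarrow> r n > 0 \<and> r n < \<alpha> + 1 \<and> Gamma (r n + 1) > c"
    by (auto simp: eventually_sequentially)
  have bnd: "\<bar>pw T \<beta> x\<bar> \<le> M * indicator {0<..<T} x" if "\<beta> > 0" "\<beta> \<le> \<alpha> + 1" "Gamma (\<beta> + 1) > c" for \<beta> x
  proof (cases "x \<in> {0<..<T}")
    case True
    have "x powr \<beta> \<le> (1 + T) powr \<beta>" using True that by (intro powr_mono2) auto
    also have "\<dots> \<le> (1 + T) powr (\<alpha> + 1)" using True that by (intro powr_mono) auto
    finally show ?thesis
      using True that c unfolding M_def pw_def restr_def by (auto intro!: frac_le)
  qed (simp add: pw_def restr_def)
  have "(\<lambda>n. norm1 (\<lambda>x. pw T (r (n + N)) x - pw T \<alpha> x)) \<longlonglongrightarrow> (\<integral>x. 0 \<partial>(lborel :: real measure))"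
    unfolding norm1_def
  proof (rule integral_dominated_convergence[where w = "\<lambda>x. 2 * (M * indicator {0<..<T} x)"])
    show "(\<lambda>x. \<bar>pw T (r (n + N)) x - pw T \<alpha> x\<bar>) \<in> borel_measurable lborel" for n
      using L1bD(2)[OF pw_L1b, of "r (n + N)" T] L1bD(2)[OF pw_L1b, of \<alpha> T] N[of "n + N"] \<alpha> T by auto
    show "AE x in lborel. (\<lambda>n. \<bar>pw T (r (n + N)) x - pw T \<alpha> x\<bar>) \<longlonglongrightarrow> 0"
    proof (intro always_eventually allI)
      fix x
      have "(\<lambda>n. pw T (r n) x) \<longlonglongrightarrow> pw T \<alpha> x"
      proof (cases "x \<in> {0<..<T}")
        case True
        then show ?thesis unfolding pw_def restr_def using Gp by (intro tendsto_intros r G) auto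
      qed (simp add: pw_def restr_def)
      then have "(\<lambda>n. pw T (r (n + N)) x) \<longlonglongrightarrow> pw T \<alpha> x" by (rule LIMSEQ_ignore_initial_segment)
      then show "(\<lambda>n. \<bar>pw T (r (n + N)) x - pw T \<alpha> x\<bar>) \<longlonglongrightarrow> 0"
        by (intro tendsto_rabs_zero) (simp add: LIM_zero_iff)
    qed
    show "AE x in lborel. norm \<bar>pw T (r (n + N)) x - pw T \<alpha> x\<bar> \<le> 2 * (M * indicator {0<..<T} x)" for n
    proof (intro always_eventually allI)
      fix x
      have "\<bar>pw T (r (n + N)) x\<bar> \<le> M * indicator {0<..<T} x" using N[of "n + N"] by (intro bnd) auto
      moreover have "\<bar>pw T \<alpha> x\<bar> \<le> M * indicator {0<..<T} x" using \<alpha> c by (intro bnd) auto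
      ultimately show "norm \<bar>pw T (r (n + N)) x - pw T \<alpha> x\<bar> \<le> 2 * (M * indicator {0<..<T} x)" by simp
    qed
    have "integrable lborel (indicator {0<..<T} :: real \<Rightarrow> real)" using T by (intro integrable_real_indicator) auto
    then show "integrable lborel (\<lambda>x. 2 * (M * indicator {0<..<T} x))" by simp
  qed simp
  then have "(\<lambda>n. norm1 (\<lambda>x. pw T (r (n + N)) x - pw T \<alpha> x)) \<longlonglongrightarrow> 0" by simp
  then show ?thesis by (rule LIMSEQ_offset)
qed

subsection \<open>Families satisfying the index law\<close>

text \<open>The hypotheses on J carried over to Borel representatives that vanish off (0,T), where
  \<open>norm1\<close> of a difference is the distance.\<close>

locale frac_family =
  fixes T :: real and K :: "real \<Rightarrow> (real \<Rightarrow> real) \<Rightarrow> real \<Rightarrow> real"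
  assumes T: "T > 0"
    and K_in: "\<And>\<alpha> f. \<alpha> > 0 \<Longrightarrow> f \<in> L1b T \<Longrightarrow> K \<alpha> f \<in> L1b T"
    and K_cong: "\<And>\<alpha> f g. \<alpha> > 0 \<Longrightarrow> f \<in> L1b T \<Longrightarrow> g \<in> L1b T \<Longrightarrow> f \<doteq> g \<Longrightarrow> K \<alpha> f \<doteq> K \<alpha> g"
    and K_add: "\<And>\<alpha> f g. \<alpha> > 0 \<Longrightarrow> f \<in> L1b T \<Longrightarrow> g \<in> L1b T \<Longrightarrow> K \<alpha> (\<lambda>t. f t + g t) \<doteq> (\<lambda>t. K \<alpha> f t + K \<alpha> g t)"
    and K_mult: "\<And>\<alpha> c f. \<alpha> > 0 \<Longrightarrow> f \<in> L1b T \<Longrightarrow> K \<alpha> (\<lambda>t. c * f t) \<doteq> (\<lambda>t. c * K \<alpha> f t)"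
    and K_cont: "\<And>\<alpha> f \<epsilon>. \<alpha> > 0 \<Longrightarrow> f \<in> L1b T \<Longrightarrow> \<epsilon> > 0 \<Longrightarrow>
      \<exists>\<delta>>0. \<forall>g\<in>L1b T. norm1 (\<lambda>x. g x - f x) < \<delta> \<longrightarrow> norm1 (\<lambda>x. K \<alpha> g x - K \<alpha> f x) < \<epsilon>"
    and K_1: "\<And>f. f \<in> L1b T \<Longrightarrow> K 1 f \<doteq> volterra T f"
    and K_index: "\<And>\<alpha> \<beta> f. \<alpha> > 0 \<Longrightarrow> \<beta> > 0 \<Longrightarrow> f \<in> L1b T \<Longrightarrow> K (\<alpha> + \<beta>) f \<doteq> K \<alpha> (K \<beta> f)"
    and K_at: "\<exists>\<alpha>\<^sub>0>0. ((\<lambda>\<alpha>. norm1 (\<lambda>x. K \<alpha> (restr T (\<lambda>_. 1)) x - K \<alpha>\<^sub>0 (restr T (\<lambda>_. 1)) x)) \<longlongrightarrow> 0) (at \<alpha>\<^sub>0)"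
begin

definition u :: "real \<Rightarrow> real \<Rightarrow> real" where
  "u \<alpha> = K \<alpha> (restr T (\<lambda>_. 1))"

lemma one_L1b: "restr T (\<lambda>_. 1) \<in> L1b T"
  using restr_bounded_L1b(1)[of "\<lambda>_. 1" T 1] T by simp

lemma u_L1b: "\<alpha> > 0 \<Longrightarrow> u \<alpha> \<in> L1b T"
  unfolding u_def by (intro K_in one_L1b)

lemma restr_conv_L1b: "f \<in> L1b T \<Longrightarrow> g \<in> L1b T \<Longrightarrow> restr T (conv f g) \<in> L1b T"
  by (intro restr_L1b integrable_conv L1bD(1))

lemma volterra_in: "f \<in> L1b T \<Longrightarrow> volterra T f \<in> L1b T"
  using volterra_L1b T by blast

text \<open>By the index law both compositions equal \<open>K (\<alpha> + 1)\<close>.\<close>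

lemma K_volterra:
  assumes "\<alpha> > 0" "f \<in> L1b T"
  shows "K \<alpha> (volterra T f) \<doteq> volterra T (K \<alpha> f)"
proof -
  have "K \<alpha> (volterra T f) \<doteq> K \<alpha> (K 1 f)"
    using assms by (intro K_cong volterra_in K_in ae_eq_sym[OF K_1]) auto
  also have "K \<alpha> (K 1 f) \<doteq> K (\<alpha> + 1) f"
    using assms by (intro ae_eq_sym[OF K_index]) auto
  also have "K (\<alpha> + 1) f \<doteq> K 1 (K \<alpha> f)"
    using K_index[of 1 \<alpha> f] assms by (simp add: add.commute)
  also have "K 1 (K \<alpha> f) \<doteq> volterra T (K \<alpha> f)"
    using assms by (intro K_1 K_in)
  finally show ?thesis .
qed

section \<open>The convolution identity for the integrated operators\<close>

text \<open>The extra integration is there because \<open>u \<alpha>\<close>, the image of the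
  constant 1, is a kernel of order \<alpha> + 1. As a predicate of f the identity can be spread step
  by step from f = 1.\<close>

definition conv_rule :: "real \<Rightarrow> (real \<Rightarrow> real) \<Rightarrow> bool" where
  "conv_rule \<alpha> f \<longleftrightarrow> volterra T (K \<alpha> f) \<doteq> restr T (conv (u \<alpha>) f)"

lemma volterra_conv_right:
  "f \<in> L1b T \<Longrightarrow> g \<in> L1b T \<Longrightarrow> volterra T (restr T (conv f g)) = restr T (conv f (volterra T g))"
  using volterra_conv[of g T f] by (simp add: conv_commute[of f])

lemma volterra_K_volterra:
  assumes "\<alpha> > 0" "f \<in> L1b T"
  shows "volterra T (K \<alpha> (volterra T f)) = volterra T (volterra T (K \<alpha> f))"
  using assms by (intro volterra_cong K_in volterra_in K_volterra)

text \<open>On the left integration commutes with \<open>K \<alpha>\<close>; on the right it passes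
  to the second factor of the convolution.\<close>

lemma conv_rule_volterra:
  assumes "\<alpha> > 0" "f \<in> L1b T" "conv_rule \<alpha> f"
  shows "conv_rule \<alpha> (volterra T f)"
proof -
  have "volterra T (K \<alpha> (volterra T f)) = volterra T (volterra T (K \<alpha> f))" using assms by (intro volterra_K_volterra)
  also have "\<dots> = volterra T (restr T (conv (u \<alpha>) f))"
    using assms by (intro volterra_cong volterra_in K_in restr_conv_L1b u_L1b) (auto simp: conv_rule_def)
  also have "\<dots> = restr T (conv (u \<alpha>) (volterra T f))"
    using assms by (intro volterra_conv_right u_L1b)
  finally show ?thesis by (simp add: conv_rule_def)
qed

text \<open>Integrating \<open>u \<alpha>\<close> is convolving it with 1, so commutativity
  suffices.\<close>

lemma conv_rule_one: "\<alpha> > 0 \<Longrightarrow> conv_rule \<alpha> (restr T (\<lambda>_. 1))"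
  unfolding conv_rule_def using volterra_eq_conv[OF u_L1b] by (simp add: u_def[symmetric] conv_commute)

lemma conv_rule_lincomb:
  assumes \<alpha>: "\<alpha> > 0" and f: "f \<in> L1b T" "conv_rule \<alpha> f" and g: "g \<in> L1b T" "conv_rule \<alpha> g"
  shows "conv_rule \<alpha> (\<lambda>x. f x + c * g x)"
proof -
  have cg: "(\<lambda>x. c * g x) \<in> L1b T" using g by (intro L1b_mult)
  note fg = L1b_add[OF f(1) cg]
  note KK = L1b_add[OF K_in[OF \<alpha> f(1)] L1b_mult[OF K_in[OF \<alpha> g(1)], of c]]
  have "K \<alpha> (\<lambda>x. f x + c * g x) \<doteq> (\<lambda>x. K \<alpha> f x + c * K \<alpha> g x)"
    using K_add[OF \<alpha> f(1) cg] K_mult[OF \<alpha> g(1), of c] by eventually_elim simp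
  then have "volterra T (K \<alpha> (\<lambda>x. f x + c * g x)) = (\<lambda>x. volterra T (K \<alpha> f) x + c * volterra T (K \<alpha> g) x)"
    using volterra_cong[OF K_in[OF \<alpha> fg] KK] volterra_lincomb[OF K_in[OF \<alpha> f(1)] K_in[OF \<alpha> g(1)], of c] by simp
  moreover have "restr T (conv (u \<alpha>) (\<lambda>x. f x + c * g x)) \<doteq> (\<lambda>x. volterra T (K \<alpha> f) x + c * volterra T (K \<alpha> g) x)"
    using f(2)[unfolded conv_rule_def] g(2)[unfolded conv_rule_def]
      conv_lincomb[OF L1bD(1)[OF u_L1b[OF \<alpha>]] L1bD(1)[OF f(1)] L1bD(1)[OF g(1)], of c]
    by eventually_elim (simp add: restr_def distrib_left mult.left_commute)
  ultimately show ?thesis unfolding conv_rule_def by (auto elim: eventually_mono)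
qed

text \<open>Both sides depend continuously on f: the left by continuity of \<open>K \<alpha>\<close>
  and boundedness of integration, the right by Young's inequality \<open>norm1_conv\<close>.\<close>

lemma conv_rule_lim:
  assumes \<alpha>: "\<alpha> > 0" and f: "f \<in> L1b T"
    and appr: "\<And>\<epsilon>. \<epsilon> > 0 \<Longrightarrow> \<exists>g\<in>L1b T. conv_rule \<alpha> g \<and> norm1 (\<lambda>x. g x - f x) < \<epsilon>"
  shows "conv_rule \<alpha> f"
proof -
  let ?A = "volterra T (K \<alpha> f)" and ?B = "restr T (conv (u \<alpha>) f)"
  note ua = u_L1b[OF \<alpha>]
  have A: "?A \<in> L1b T" using \<alpha> f by (intro volterra_in K_in)
  have B: "?B \<in> L1b T" using ua f by (rule restr_conv_L1b)
  have "norm1 (\<lambda>x. ?A x - ?B x) \<le> \<epsilon>" if \<epsilon>: "\<epsilon> > 0" for \<epsilon>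
  proof -
    \<comment> \<open>The left side contributes an error T e and the right side
      \<open>norm1 (u \<alpha>)\<close> times e; together they stay below \<epsilon>.\<close>
    define e where "e = \<epsilon> / (T + norm1 (u \<alpha>) + 1)"
    have pos: "T + norm1 (u \<alpha>) + 1 > 0" using T norm1_nonneg[of "u \<alpha>"] by linarith
    then have e: "e > 0" using \<epsilon> by (simp add: e_def)
    obtain \<delta> where \<delta>: "\<delta> > 0" "\<And>g. g \<in> L1b T \<Longrightarrow> norm1 (\<lambda>x. g x - f x) < \<delta> \<Longrightarrow> norm1 (\<lambda>x. K \<alpha> g x - K \<alpha> f x) < e"
      using K_cont[OF \<alpha> f e] by blast
    obtain g where g: "g \<in> L1b T" "conv_rule \<alpha> g" "norm1 (\<lambda>x. g x - f x) < min \<delta> e"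
      using appr[of "min \<delta> e"] \<delta>(1) e by auto
    note gf = L1b_diff[OF g(1) f]
    let ?C = "volterra T (K \<alpha> g)" and ?D = "restr T (conv (u \<alpha>) g)"
    have C: "?C \<in> L1b T" using \<alpha> g by (intro volterra_in K_in)
    have "norm1 (\<lambda>x. ?A x - ?C x) = norm1 (volterra T (\<lambda>x. K \<alpha> g x - K \<alpha> f x))"
      using volterra_diff[OF K_in[OF \<alpha> g(1)] K_in[OF \<alpha> f]] norm1_minus_commute[of ?A ?C] by simp
    also have "\<dots> \<le> T * norm1 (\<lambda>x. K \<alpha> g x - K \<alpha> f x)"
      by (intro norm1_volterra L1b_diff K_in \<alpha> g f T)
    also have "\<dots> \<le> T * e" using T g \<delta>(2)[OF g(1)] by (intro mult_left_mono) auto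
    finally have 1: "norm1 (\<lambda>x. ?A x - ?C x) \<le> T * e" .
    have "conv (u \<alpha>) (\<lambda>x. g x + (-1) * f x) \<doteq> (\<lambda>x. conv (u \<alpha>) g x + (-1) * conv (u \<alpha>) f x)"
      by (intro conv_lincomb L1bD(1)[OF ua] L1bD(1)[OF g(1)] L1bD(1)[OF f])
    with g(2)[unfolded conv_rule_def] have "(\<lambda>x. ?C x - ?B x) \<doteq> restr T (conv (u \<alpha>) (\<lambda>x. g x - f x))"
      by eventually_elim (simp add: restr_def right_diff_distrib)
    then have "norm1 (\<lambda>x. ?C x - ?B x) = norm1 (restr T (conv (u \<alpha>) (\<lambda>x. g x - f x)))"
      by (rule norm1_cong) (use L1bD(2)[OF L1b_diff[OF C B]] L1bD(2)[OF restr_conv_L1b[OF ua gf]] in auto)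
    also have "\<dots> \<le> norm1 (conv (u \<alpha>) (\<lambda>x. g x - f x))"
      by (intro norm1_restr_le integrable_conv L1bD(1)[OF ua] L1bD(1)[OF gf])
    also have "\<dots> \<le> norm1 (u \<alpha>) * norm1 (\<lambda>x. g x - f x)"
      by (intro norm1_conv L1bD(1)[OF ua] L1bD(1)[OF gf])
    also have "\<dots> \<le> norm1 (u \<alpha>) * e" using g(3) by (intro mult_left_mono norm1_nonneg) simp
    finally have "norm1 (\<lambda>x. ?A x - ?B x) \<le> T * e + norm1 (u \<alpha>) * e"
      using 1 norm1_triangle[OF L1bD(1)[OF A] L1bD(1)[OF C] L1bD(1)[OF B]] by linarith
    also have "\<dots> \<le> (T + norm1 (u \<alpha>) + 1) * e" using e by (simp add: algebra_simps)
    also have "\<dots> = \<epsilon>" using pos by (simp add: e_def)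
    finally show ?thesis .
  qed
  then have "norm1 (\<lambda>x. ?A x - ?B x) \<le> 0" by (rule field_le_epsilon[of _ 0, simplified])
  then have "norm1 (\<lambda>x. ?A x - ?B x) = 0" using norm1_nonneg by (rule antisym)
  then have "(\<lambda>x. ?A x - ?B x) \<doteq> (\<lambda>_. 0)" by (intro norm1_zero_iff L1bD(1)[OF L1b_diff[OF A B]])
  then show ?thesis unfolding conv_rule_def by simp
qed

text \<open>These functions are the iterated integrals of the constant 1.\<close>

lemma conv_rule_pw: "\<alpha> > 0 \<Longrightarrow> conv_rule \<alpha> (pw T (real n))"
proof (induction n)
  case 0
  then show ?case using conv_rule_one by (simp add: pw_0)
next
  case (Suc n)
  then have "conv_rule \<alpha> (volterra T (pw T (real n)))" using T by (intro conv_rule_volterra pw_L1b) auto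
  then show ?case using volterra_pw[of "real n" T] T by (simp add: add.commute)
qed

lemma monomial_eq_pw: "restr T (\<lambda>x. x ^ n) = (\<lambda>x. Gamma (real n + 1) * pw T (real n) x)"
proof
  fix x
  have "Gamma (real n + 1) \<noteq> 0" using Gamma_real_pos[of "real n + 1"] by linarith
  then show "restr T (\<lambda>x. x ^ n) x = Gamma (real n + 1) * pw T (real n) x"
    by (cases "x \<in> {0<..<T}") (auto simp: pw_def restr_def powr_realpow)
qed

lemma conv_rule_poly:
  assumes \<alpha>: "\<alpha> > 0"
  shows "restr T (\<lambda>x. \<Sum>i\<in>{..<n}. a i * x ^ i) \<in> L1b T \<and> conv_rule \<alpha> (restr T (\<lambda>x. \<Sum>i\<in>{..<n}. a i * x ^ i))"
proof (induction n)
  case 0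
  \<comment> \<open>The zero function is obtained as 1 - 1, a combination for which the rule is
    already available.\<close>
  have "conv_rule \<alpha> (\<lambda>x. restr T (\<lambda>_. 1) x + (-1) * restr T (\<lambda>_. 1) x)"
    by (intro conv_rule_lincomb \<alpha> one_L1b conv_rule_one)
  moreover have "restr T (\<lambda>x. 0) = (\<lambda>x. 0)" by (rule ext) (simp add: restr_def)
  ultimately show ?case by (simp add: L1b_zero)
next
  case (Suc n)
  let ?p = "restr T (\<lambda>x. \<Sum>i\<in>{..<n}. a i * x ^ i)"
  have pw: "pw T (real n) \<in> L1b T" using T by (intro pw_L1b) auto
  have "restr T (\<lambda>x. \<Sum>i\<in>{..<Suc n}. a i * x ^ i) = (\<lambda>x. ?p x + a n * restr T (\<lambda>x. x ^ n) x)"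
    by (rule ext) (simp add: restr_def distrib_left mult.left_commute)
  also have "\<dots> = (\<lambda>x. ?p x + (a n * Gamma (real n + 1)) * pw T (real n) x)"
    by (simp add: monomial_eq_pw mult.assoc)
  finally show ?case
    using Suc conv_rule_lincomb[OF \<alpha> _ _ pw conv_rule_pw[OF \<alpha>], of ?p] L1b_add[OF _ L1b_mult[OF pw], of ?p] by simp
qed

lemma conv_rule_continuous:
  assumes \<alpha>: "\<alpha> > 0" and F: "continuous_on UNIV F" and f: "restr T F \<in> L1b T"
  shows "conv_rule \<alpha> (restr T F)"
proof (rule conv_rule_lim[OF \<alpha> f])
  fix \<epsilon> :: real assume \<epsilon>: "\<epsilon> > 0"
  \<comment> \<open>A uniform error e on (0,T) is an error of at most T e in norm.\<close>
  define e where "e = \<epsilon> / (2 * T)"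
  have e: "e > 0" "T * e < \<epsilon>" using \<epsilon> T by (auto simp: e_def)
  obtain p where p: "real_polynomial_function p" "\<And>x. x \<in> {0..T} \<Longrightarrow> \<bar>F x - p x\<bar> < e"
    using Stone_Weierstrass_real_polynomial_function[of "{0..T}" F e] continuous_on_subset[OF F, of "{0..T}"] e by auto
  from p(1) obtain a n where pn: "p = (\<lambda>x. \<Sum>i\<le>n. a i * x ^ i)"
    by (auto simp: real_polynomial_function_iff_sum)
  then have pn: "p = (\<lambda>x. \<Sum>i\<in>{..<Suc n}. a i * x ^ i)" by (simp only: lessThan_Suc_atMost)
  have pg: "restr T p \<in> L1b T" "conv_rule \<alpha> (restr T p)"
    using conv_rule_poly[OF \<alpha>, where n = "Suc n" and a = a] by (simp_all only: pn)
  have pc: "continuous_on UNIV p"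
    unfolding pn by (intro continuous_intros)
  have "norm1 (restr T (\<lambda>x. p x - F x)) \<le> T * e"
  proof (rule restr_bounded_L1b(2))
    show "(\<lambda>x. p x - F x) \<in> borel_measurable borel"
      by (intro borel_measurable_continuous_onI continuous_intros pc F)
    show "\<bar>p x - F x\<bar> \<le> e" if "x \<in> {0<..<T}" for x
      using p(2)[of x] that by (simp add: abs_minus_commute)
  qed (rule T)
  also have "restr T (\<lambda>x. p x - F x) = (\<lambda>x. restr T p x - restr T F x)"
    by (rule ext) (simp add: restr_def right_diff_distrib)
  finally show "\<exists>g\<in>L1b T. conv_rule \<alpha> g \<and> norm1 (\<lambda>x. g x - restr T F x) < \<epsilon>"
    using pg e by (intro bexI[of _ "restr T p"]) auto
qed

text \<open>The integral of f agrees on (0,T) with a continuous function, so the rule holds for it.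
  Both of its sides are then integrals of the two sides claimed here, and injectivity of integration
  removes the outer integral.\<close>

lemma volterra_K_eq_conv:
  assumes \<alpha>: "\<alpha> > 0" and f: "f \<in> L1b T"
  shows "volterra T (K \<alpha> f) \<doteq> restr T (conv (u \<alpha>) f)"
proof (rule prim_inj_volterra[OF _ _ T])
  show "volterra T (K \<alpha> f) \<in> L1b T" using \<alpha> f by (intro volterra_in K_in)
  show "restr T (conv (u \<alpha>) f) \<in> L1b T" using \<alpha> f by (intro restr_conv_L1b u_L1b)
  have "conv_rule \<alpha> (volterra T f)"
    using conv_rule_continuous[OF \<alpha> prim_continuous[OF L1bD(1)[OF f]]] volterra_in[OF f] by (simp add: volterra_def)
  then show "volterra T (volterra T (K \<alpha> f)) \<doteq> volterra T (restr T (conv (u \<alpha>) f))"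
    using volterra_conv_right[OF u_L1b[OF \<alpha>] f] volterra_K_volterra[OF \<alpha> f] by (simp add: conv_rule_def)
qed

text \<open>The index law at the constant 1, integrated once: each side becomes a
  convolution.\<close>

lemma conv_u_u:
  assumes "\<alpha> > 0" "\<beta> > 0"
  shows "restr T (conv (u \<alpha>) (u \<beta>)) \<doteq> restr T (conv (restr T (\<lambda>_. 1)) (u (\<alpha> + \<beta>)))"
proof -
  have "u (\<alpha> + \<beta>) \<doteq> K \<alpha> (u \<beta>)"
    unfolding u_def using assms by (intro K_index one_L1b)
  then have "volterra T (u (\<alpha> + \<beta>)) = volterra T (K \<alpha> (u \<beta>))"
    using assms by (intro volterra_cong u_L1b K_in) auto
  moreover have "volterra T (u (\<alpha> + \<beta>)) = restr T (conv (restr T (\<lambda>_. 1)) (u (\<alpha> + \<beta>)))"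
    using assms by (intro volterra_eq_conv u_L1b) auto
  ultimately show ?thesis using volterra_K_eq_conv[OF assms(1) u_L1b[OF assms(2)]] by (auto elim: eventually_mono)
qed

section \<open>The index law for Laplace transforms and rational orders\<close>

text \<open>The factor s makes the index law multiplicative, with s to the power - \<alpha> as
  expected value.\<close>

definition B :: "real \<Rightarrow> real \<Rightarrow> real" where
  "B \<alpha> s = s * laplace (u \<alpha>) s"

text \<open>Boundedness, written with \<open>s powr 0\<close> to fit the growth hypothesis of
  \<open>negl_mult\<close>.\<close>

lemma laplace_u_bigo: "\<alpha> > 0 \<Longrightarrow> laplace (u \<alpha>) \<in> O(\<lambda>s. s powr 0)"
  using integrable_laplace(2)[OF u_L1b]
  by (intro bigoI[of _ "norm1 (u \<alpha>)"] eventually_mono[OF eventually_gt_at_top[of 0]]) auto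

lemma B_bigo: "\<alpha> > 0 \<Longrightarrow> B \<alpha> \<in> O(\<lambda>s. s powr 1)"
proof -
  assume "\<alpha> > 0"
  have "(\<lambda>s. s * laplace (u \<alpha>) s) \<in> O(\<lambda>s. s powr 1 * s powr 0)"
    by (intro landau_o.big.mult laplace_u_bigo \<open>\<alpha> > 0\<close>) real_asymp
  also have "(\<lambda>s::real. s powr 1 * s powr 0) \<in> O(\<lambda>s. s powr 1)" by real_asymp
  finally show ?thesis by (simp add: B_def[abs_def])
qed

lemma negl_square_mult: "negl T F \<Longrightarrow> negl T (\<lambda>s. F s * s ^ 2)"
proof (rule negl_mult[where c = 2])
  show "(\<lambda>s::real. s ^ 2) \<in> O(\<lambda>s. s powr 2)" by real_asymp
qed

text \<open>The two convolutions in \<open>conv_u_u\<close> have the same transform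
  \<open>c1\<close>. The errors \<open>n1\<close> and \<open>n2\<close> come from truncating them,
  \<open>n3\<close> from replacing the transform of 1 by 1 / s; multiplication by the square of s
  then gives the claim.\<close>

lemma B_mult:
  assumes \<alpha>: "\<alpha> > 0" and \<beta>: "\<beta> > 0"
  shows "negl T (\<lambda>s. B (\<alpha> + \<beta>) s - B \<alpha> s * B \<beta> s)"
proof -
  let ?one = "restr T (\<lambda>_. 1)"
  note ua = u_L1b[OF \<alpha>] and ub = u_L1b[OF \<beta>]
  have uab: "u (\<alpha> + \<beta>) \<in> L1b T" using \<alpha> \<beta> by (intro u_L1b) simp
  define c1 where "c1 = laplace (restr T (conv (u \<alpha>) (u \<beta>)))"
  have c1: "c1 = laplace (restr T (conv ?one (u (\<alpha> + \<beta>))))"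
    unfolding c1_def
    using L1bD(2)[OF restr_conv_L1b[OF ua ub]] L1bD(2)[OF restr_conv_L1b[OF one_L1b uab]]
    by (intro laplace_AE_cong conv_u_u \<alpha> \<beta>)
  have n1: "negl T (\<lambda>s. laplace (u \<alpha>) s * laplace (u \<beta>) s - c1 s)"
    using laplace_conv[OF ua ub] unfolding c1_def
    by (intro negl_bound[where C = "norm1 (u \<alpha>) * norm1 (u \<beta>)"]) (simp add: mult.assoc)
  have n2: "negl T (\<lambda>s. laplace ?one s * laplace (u (\<alpha> + \<beta>)) s - c1 s)"
    using laplace_conv[OF one_L1b uab] unfolding c1
    by (intro negl_bound[where C = "norm1 ?one * norm1 (u (\<alpha> + \<beta>))"]) (simp add: mult.assoc)
  have n3: "negl T (\<lambda>s. (laplace ?one s - s powr (-1)) * laplace (u (\<alpha> + \<beta>)) s)"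
    using laplace_pw[of 0 T] T \<alpha> \<beta> by (intro negl_mult[OF _ laplace_u_bigo]) (auto simp: pw_0)
  show ?thesis
  proof (rule negl_mono[OF negl_square_mult[OF negl_diff[OF negl_diff[OF n2 n1] n3]]])
    show "\<forall>\<^sub>F s in at_top. \<bar>B (\<alpha> + \<beta>) s - B \<alpha> s * B \<beta> s\<bar> \<le>
      \<bar>(laplace ?one s * laplace (u (\<alpha> + \<beta>)) s - c1 s - (laplace (u \<alpha>) s * laplace (u \<beta>) s - c1 s)
         - (laplace ?one s - s powr (-1)) * laplace (u (\<alpha> + \<beta>)) s) * s ^ 2\<bar>"
      using eventually_gt_at_top[of 0]
    proof eventually_elim
      case (elim s)
      then have "s powr (-1) = 1 / s" by (simp add: powr_minus divide_inverse)
      then have "(laplace ?one s * laplace (u (\<alpha> + \<beta>)) s - c1 s - (laplace (u \<alpha>) s * laplace (u \<beta>) s - c1 s)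
         - (laplace ?one s - s powr (-1)) * laplace (u (\<alpha> + \<beta>)) s) * s ^ 2 = B (\<alpha> + \<beta>) s - B \<alpha> s * B \<beta> s"
        using elim by (simp add: B_def power2_eq_square field_simps)
      then show ?case by simp
    qed
  qed
qed

text \<open>In the induction the accumulated error is multiplied by \<open>B \<alpha>\<close>, whose
  growth is at most polynomial, and so stays negligible.\<close>

lemma B_power:
  assumes \<alpha>: "\<alpha> > 0"
  shows "negl T (\<lambda>s. B (real (Suc n) * \<alpha>) s - B \<alpha> s ^ Suc n)"
proof (induction n)
  case 0
  show ?case by (simp add: negl_def)
next
  case (Suc n)
  have 1: "negl T (\<lambda>s. B (real (Suc n) * \<alpha> + \<alpha>) s - B (real (Suc n) * \<alpha>) s * B \<alpha> s)"
    using \<alpha> by (intro B_mult) auto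
  have 2: "negl T (\<lambda>s. (B (real (Suc n) * \<alpha>) s - B \<alpha> s ^ Suc n) * B \<alpha> s)"
    by (rule negl_mult[OF Suc B_bigo[OF \<alpha>]])
  have eq: "real (Suc (Suc n)) * \<alpha> = real (Suc n) * \<alpha> + \<alpha>" by (simp add: algebra_simps)
  show ?case
    using negl_add[OF 1 2] unfolding eq by (simp add: algebra_simps)
qed

lemma u_nat: "u (real (Suc n)) \<doteq> pw T (real (Suc n))"
proof (induction n)
  case 0
  show ?case using K_1[OF one_L1b] volterra_pw[of 0 T] T by (simp add: u_def pw_0)
next
  case (Suc n)
  have "u (real (Suc (Suc n))) \<doteq> K 1 (u (real (Suc n)))"
    using K_index[of 1 "real (Suc n)", OF _ _ one_L1b] by (simp add: u_def)
  also have "K 1 (u (real (Suc n))) \<doteq> volterra T (u (real (Suc n)))"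
    by (intro K_1 u_L1b) simp
  also have "volterra T (u (real (Suc n))) = volterra T (pw T (real (Suc n)))"
    using T by (intro volterra_cong u_L1b pw_L1b Suc) auto
  also have "\<dots> = pw T (real (Suc (Suc n)))"
    using volterra_pw[of "real (Suc n)" T] T by (simp add: add_ac)
  finally show ?case .
qed

lemma B_negl_of_u_eq_pw:
  assumes "\<alpha> > 0" "u \<alpha> \<doteq> pw T \<alpha>"
  shows "negl T (\<lambda>s. B \<alpha> s - s powr (- \<alpha>))"
proof -
  have "laplace (u \<alpha>) = laplace (pw T \<alpha>)"
    using assms T by (intro laplace_AE_cong L1bD(2)[OF u_L1b] L1bD(2)[OF pw_L1b]) auto
  then have "negl T (\<lambda>s. laplace (u \<alpha>) s - s powr (- (\<alpha> + 1)))"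
    using laplace_pw[of \<alpha> T] assms T by simp
  then have "negl T (\<lambda>s. (laplace (u \<alpha>) s - s powr (- (\<alpha> + 1))) * s)"
    by (rule negl_mult[where c = 1]) real_asymp
  then show ?thesis
  proof (rule negl_mono)
    show "\<forall>\<^sub>F s in at_top. \<bar>B \<alpha> s - s powr (- \<alpha>)\<bar> \<le> \<bar>(laplace (u \<alpha>) s - s powr (- (\<alpha> + 1))) * s\<bar>"
      using eventually_gt_at_top[of 0]
    proof eventually_elim
      case (elim s)
      have "s powr (- (\<alpha> + 1)) = s powr (- \<alpha>) / s"
        using powr_diff[of s "- \<alpha>" 1] elim by simp
      then have "(laplace (u \<alpha>) s - s powr (- (\<alpha> + 1))) * s = B \<alpha> s - s powr (- \<alpha>)"
        using elim by (simp add: B_def field_simps)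
      then show ?case by simp
    qed
  qed
qed

text \<open>Division by s makes the transform of the difference of \<open>u \<alpha>\<close> and
  \<open>pw T \<alpha>\<close> negligible, so the difference vanishes by
  \<open>laplace_negl_imp_zero\<close>.\<close>

lemma u_eq_pw_of_B:
  assumes \<alpha>: "\<alpha> > 0" and n: "negl T (\<lambda>s. B \<alpha> s - s powr (- \<alpha>))"
  shows "u \<alpha> \<doteq> pw T \<alpha>"
proof -
  have pw: "pw T \<alpha> \<in> L1b T" using \<alpha> T by (intro pw_L1b) auto
  note d = L1b_diff[OF u_L1b[OF \<alpha>] pw]
  have 1: "negl T (\<lambda>s. (B \<alpha> s - s powr (- \<alpha>)) * s powr (-1))"
    by (rule negl_mult[OF n, where c = "-1"]) simp
  have 2: "negl T (\<lambda>s. laplace (pw T \<alpha>) s - s powr (- (\<alpha> + 1)))"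
    using \<alpha> T by (intro laplace_pw) auto
  have "negl T (laplace (\<lambda>x. u \<alpha> x - pw T \<alpha> x))"
  proof (rule negl_mono[OF negl_diff[OF 1 2]])
    show "\<forall>\<^sub>F s in at_top. \<bar>laplace (\<lambda>x. u \<alpha> x - pw T \<alpha> x) s\<bar>
      \<le> \<bar>(B \<alpha> s - s powr (- \<alpha>)) * s powr (-1) - (laplace (pw T \<alpha>) s - s powr (- (\<alpha> + 1)))\<bar>"
      using eventually_gt_at_top[of 0]
    proof eventually_elim
      case (elim s)
      have p: "s powr (- (\<alpha> + 1)) = s powr (- \<alpha>) / s" "s powr (-1) = 1 / s"
        using powr_diff[of s "- \<alpha>" 1] elim by (simp_all add: powr_minus divide_inverse)
      have "(B \<alpha> s - s powr (- \<alpha>)) * s powr (-1) - (laplace (pw T \<alpha>) s - s powr (- (\<alpha> + 1)))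
        = laplace (u \<alpha>) s - laplace (pw T \<alpha>) s"
        unfolding p B_def using elim by (simp add: field_simps)
      then show ?case using laplace_diff[OF u_L1b[OF \<alpha>] pw, of s] elim by simp
    qed
  qed
  from laplace_negl_imp_zero[OF d T this] show ?thesis by simp
qed

lemma u_rat: "u (real (Suc p) / real (Suc q)) \<doteq> pw T (real (Suc p) / real (Suc q))"
proof -
  define \<alpha> where "\<alpha> = real (Suc p) / real (Suc q)"
  have \<alpha>: "\<alpha> > 0" by (simp add: \<alpha>_def)
  \<comment> \<open>A square, hence nonnegative: this fixes the sign when the root of order q + 1 is
    extracted.\<close>
  define z where "z = (\<lambda>s. B (\<alpha> / 2) s ^ 2)"
  have q\<alpha>: "real (Suc q) * \<alpha> = real (Suc p)" by (simp add: \<alpha>_def)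
  \<comment> \<open>Adding up 2 (q + 1) copies of \<alpha> / 2 gives the integer order p + 1, where
    the transform is known.\<close>
  have "negl T (\<lambda>s. B (real (Suc (2 * q + 1)) * (\<alpha> / 2)) s - B (\<alpha> / 2) s ^ Suc (2 * q + 1))"
    using \<alpha> by (intro B_power) simp
  moreover have "real (Suc (2 * q + 1)) * (\<alpha> / 2) = real (Suc p)" using q\<alpha> by (simp add: algebra_simps)
  moreover have "B (\<alpha> / 2) s ^ Suc (2 * q + 1) = z s ^ Suc q" for s
    by (simp add: z_def flip: power_mult power_add)
  ultimately have 1: "negl T (\<lambda>s. B (real (Suc p)) s - z s ^ Suc q)" by (simp only:)
  have "negl T (\<lambda>s. B (real (Suc 1) * (\<alpha> / 2)) s - B (\<alpha> / 2) s ^ Suc 1)"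
    using \<alpha> by (intro B_power) simp
  then have 2: "negl T (\<lambda>s. B \<alpha> s - z s)" by (simp add: z_def power2_eq_square)
  have 3: "negl T (\<lambda>s. B (real (Suc p)) s - s powr (- real (Suc p)))"
    by (intro B_negl_of_u_eq_pw u_nat) simp
  \<comment> \<open>The power of s compensates the factor y ^ q, with y = s powr - \<alpha>, lost in
    the root extraction; its growth is polynomial.\<close>
  have "negl T (\<lambda>s. (z s ^ Suc q - s powr (- real (Suc p))) * s powr (\<alpha> * real q))"
    using negl_mult[OF negl_diff[OF 3 1], of "\<lambda>s. s powr (\<alpha> * real q)" "\<alpha> * real q"] by simp
  then have 4: "negl T (\<lambda>s. z s - s powr (- \<alpha>))"
  proof (rule negl_mono)
    show "\<forall>\<^sub>F s in at_top. \<bar>z s - s powr (- \<alpha>)\<bar> \<le> \<bar>(z s ^ Suc q - s powr (- real (Suc p))) * s powr (\<alpha> * real q)\<bar>"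
      using eventually_gt_at_top[of 0]
    proof eventually_elim
      case (elim s)
      have pn: "(s powr (- \<alpha>)) ^ n = s powr (- (\<alpha> * real n))" for n
        using elim by (simp add: powr_powr flip: powr_realpow)
      have "\<bar>z s - s powr (- \<alpha>)\<bar> * s powr (- (\<alpha> * real q)) \<le> \<bar>z s ^ Suc q - s powr (- real (Suc p))\<bar>"
        using diff_mult_power_le_diff_power[of "z s" "s powr (- \<alpha>)" q] q\<alpha> unfolding pn
        by (simp add: z_def mult.commute)
      then have "\<bar>z s - s powr (- \<alpha>)\<bar> * s powr (- (\<alpha> * real q)) * s powr (\<alpha> * real q)
          \<le> \<bar>z s ^ Suc q - s powr (- real (Suc p))\<bar> * s powr (\<alpha> * real q)"
        by (rule mult_right_mono) simp
      then show ?case using elim by (simp add: abs_mult mult.assoc flip: powr_add)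
    qed
  qed
  show ?thesis
    using u_eq_pw_of_B[OF \<alpha>] negl_add[OF 2 4] by (simp add: \<alpha>_def)
qed

lemma u_Rats: "\<alpha> > 0 \<Longrightarrow> \<alpha> \<in> \<rat> \<Longrightarrow> u \<alpha> \<doteq> pw T \<alpha>"
proof -
  assume "\<alpha> > 0" "\<alpha> \<in> \<rat>"
  obtain m n :: nat where mn: "n \<noteq> 0" "\<bar>\<alpha>\<bar> = real m / real n"
    by (rule Rats_abs_nat_div_natE[OF \<open>\<alpha> \<in> \<rat>\<close>])
  with \<open>\<alpha> > 0\<close> have "m \<noteq> 0" by (auto intro!: Nat.gr0I)
  with mn obtain p q where "m = Suc p" "n = Suc q" by (metis not0_implies_Suc)
  with mn \<open>\<alpha> > 0\<close> have "\<alpha> = real (Suc p) / real (Suc q)" by simp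
  then show ?thesis using u_rat by simp
qed

section \<open>From rational to real orders\<close>

text \<open>Take rationals r tending to \<alpha> = \<beta> + \<open>\<alpha>\<^sub>0\<close>.
  Continuity at \<open>\<alpha>\<^sub>0\<close> applies to \<open>u (r - \<beta>)\<close>, and
  continuity of \<open>K \<beta>\<close> carries it to \<open>u r\<close>, which is the power
  function of order r.\<close>

lemma u_large: "\<exists>\<alpha>\<^sub>0. \<forall>\<alpha>>\<alpha>\<^sub>0. u \<alpha> \<doteq> pw T \<alpha>"
proof -
  obtain \<alpha>\<^sub>0 where \<alpha>\<^sub>0: "\<alpha>\<^sub>0 > 0" and lim: "((\<lambda>\<alpha>. norm1 (\<lambda>x. u \<alpha> x - u \<alpha>\<^sub>0 x)) \<longlongrightarrow> 0) (at \<alpha>\<^sub>0)"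
    using K_at unfolding u_def by blast
  have "u \<alpha> \<doteq> pw T \<alpha>" if "\<alpha> > \<alpha>\<^sub>0" for \<alpha>
  proof -
    define \<beta> where "\<beta> = \<alpha> - \<alpha>\<^sub>0"
    have \<beta>: "\<beta> > 0" "\<alpha> = \<beta> + \<alpha>\<^sub>0" and \<alpha>: "\<alpha> > 0" using that \<alpha>\<^sub>0 by (auto simp: \<beta>_def)
    \<comment> \<open>Approaching strictly from above keeps r - \<beta> positive and different from
      \<open>\<alpha>\<^sub>0\<close>, as the punctured limit requires.\<close>
    have "\<exists>r\<in>\<rat>. \<alpha> < r \<and> r < \<alpha> + 1 / real (Suc n)" for n
      by (rule Rats_dense_in_real) simp
    then obtain r where r: "\<And>n. r n \<in> \<rat>" "\<And>n. \<alpha> < r n" "\<And>n. r n < \<alpha> + 1 / real (Suc n)" by metis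
    have r\<alpha>: "r \<longlonglongrightarrow> \<alpha>"
    proof (rule real_tendsto_sandwich[of "\<lambda>_. \<alpha>" r sequentially "\<lambda>n. \<alpha> + 1 / real (Suc n)"])
      show "(\<lambda>n. \<alpha> + 1 / real (Suc n)) \<longlonglongrightarrow> \<alpha>" by real_asymp
    qed (use r in \<open>auto intro!: always_eventually less_imp_le\<close>)
    have pw: "pw T \<alpha> \<in> L1b T" using \<alpha> T by (intro pw_L1b) auto
    have rpos: "r n > 0" "r n - \<beta> > 0" for n using r(2)[of n] \<alpha> \<alpha>\<^sub>0 \<beta> by linarith+
    have "(\<lambda>n. r n - \<beta>) \<longlonglongrightarrow> \<alpha>\<^sub>0" using tendsto_diff[OF r\<alpha> tendsto_const[of \<beta>]] \<beta> by simp
    moreover have "r n - \<beta> \<noteq> \<alpha>\<^sub>0" for n using r(2)[of n] \<beta> by linarith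
    ultimately have "filterlim (\<lambda>n. r n - \<beta>) (at \<alpha>\<^sub>0) sequentially"
      by (auto simp: filterlim_at)
    from filterlim_compose[OF lim this]
    have l1: "(\<lambda>n. norm1 (\<lambda>x. u (r n - \<beta>) x - u \<alpha>\<^sub>0 x)) \<longlonglongrightarrow> 0" .
    have "norm1 (\<lambda>x. u \<alpha> x - pw T \<alpha> x) \<le> \<epsilon>" if \<epsilon>: "\<epsilon> > 0" for \<epsilon>
    proof -
      from \<epsilon> have "\<epsilon> / 2 > 0" by simp
      from K_cont[OF \<beta>(1) u_L1b[OF \<alpha>\<^sub>0] this] obtain \<delta> where \<delta>: "\<delta> > 0"
        "\<And>g. g \<in> L1b T \<Longrightarrow> norm1 (\<lambda>x. g x - u \<alpha>\<^sub>0 x) < \<delta> \<Longrightarrow> norm1 (\<lambda>x. K \<beta> g x - K \<beta> (u \<alpha>\<^sub>0) x) < \<epsilon> / 2"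
        by blast
      have "\<forall>\<^sub>F n in sequentially. norm1 (\<lambda>x. u (r n - \<beta>) x - u \<alpha>\<^sub>0 x) < \<delta> \<and> norm1 (\<lambda>x. pw T (r n) x - pw T \<alpha> x) < \<epsilon> / 2"
        using order_tendstoD(2)[OF l1 \<delta>(1)] order_tendstoD(2)[OF pw_tendsto[OF r\<alpha> \<alpha> T] \<open>\<epsilon> / 2 > 0\<close>]
        by (rule eventually_conj)
      then obtain n where n: "norm1 (\<lambda>x. u (r n - \<beta>) x - u \<alpha>\<^sub>0 x) < \<delta>" "norm1 (\<lambda>x. pw T (r n) x - pw T \<alpha> x) < \<epsilon> / 2"
        by (auto dest: eventually_happens)
      have pr: "pw T (r n) \<in> L1b T" using rpos(1)[of n] T by (intro pw_L1b) auto
      have k: "norm1 (\<lambda>x. K \<beta> (u (r n - \<beta>)) x - K \<beta> (u \<alpha>\<^sub>0) x) < \<epsilon> / 2"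
        by (rule \<delta>(2)[OF u_L1b[OF rpos(2)] n(1)])
      have e1: "u \<alpha> \<doteq> K \<beta> (u \<alpha>\<^sub>0)" unfolding u_def \<beta>(2) by (intro K_index \<beta> \<alpha>\<^sub>0 one_L1b)
      have "u (\<beta> + (r n - \<beta>)) \<doteq> K \<beta> (u (r n - \<beta>))" unfolding u_def by (intro K_index \<beta> rpos one_L1b)
      then have e2: "K \<beta> (u (r n - \<beta>)) \<doteq> pw T (r n)"
        using u_Rats[OF rpos(1) r(1), of n] by eventually_elim simp
      have "(\<lambda>x. K \<beta> (u (r n - \<beta>)) x - K \<beta> (u \<alpha>\<^sub>0) x) \<doteq> (\<lambda>x. pw T (r n) x - u \<alpha> x)"
        using e1 e2 by eventually_elim simp
      then have "norm1 (\<lambda>x. K \<beta> (u (r n - \<beta>)) x - K \<beta> (u \<alpha>\<^sub>0) x) = norm1 (\<lambda>x. pw T (r n) x - u \<alpha> x)"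
        by (rule norm1_cong)
          (intro L1bD(2)[OF L1b_diff, of _ T] K_in u_L1b \<beta> rpos \<alpha>\<^sub>0 \<alpha> pr)+
      then have "norm1 (\<lambda>x. u \<alpha> x - pw T (r n) x) < \<epsilon> / 2" using k norm1_minus_commute[of "u \<alpha>" "pw T (r n)"] by linarith
      then show ?thesis
        using n(2) norm1_triangle[OF L1bD(1)[OF u_L1b[OF \<alpha>]] L1bD(1)[OF pr] L1bD(1)[OF pw]] by linarith
    qed
    then have "norm1 (\<lambda>x. u \<alpha> x - pw T \<alpha> x) \<le> 0" by (rule field_le_epsilon[of _ 0, simplified])
    then have "norm1 (\<lambda>x. u \<alpha> x - pw T \<alpha> x) = 0" using norm1_nonneg by (rule antisym)
    then have "(\<lambda>x. u \<alpha> x - pw T \<alpha> x) \<doteq> (\<lambda>_. 0)" by (intro norm1_zero_iff L1bD(1)[OF L1b_diff[OF u_L1b[OF \<alpha>] pw]])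
    then show ?thesis by simp
  qed
  then show ?thesis by blast
qed

text \<open>Integrating \<open>u \<alpha>\<close> gives \<open>u (\<alpha> + 1)\<close>, and
  likewise for the power functions; integration is injective.\<close>

lemma u_eq_pw_descend:
  assumes \<alpha>: "\<alpha> > 0" and e: "u (\<alpha> + 1) \<doteq> pw T (\<alpha> + 1)"
  shows "u \<alpha> \<doteq> pw T \<alpha>"
proof (rule prim_inj_volterra[OF u_L1b[OF \<alpha>] _ T])
  show "pw T \<alpha> \<in> L1b T" using \<alpha> T by (intro pw_L1b) auto
  have "volterra T (u \<alpha>) \<doteq> K 1 (u \<alpha>)" by (intro ae_eq_sym[OF K_1] u_L1b \<alpha>)
  also have "K 1 (u \<alpha>) \<doteq> u (1 + \<alpha>)" unfolding u_def using \<alpha> by (intro ae_eq_sym[OF K_index] one_L1b) auto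
  also have "u (1 + \<alpha>) \<doteq> volterra T (pw T \<alpha>)" using e volterra_pw[of \<alpha> T] \<alpha> T by (simp add: add.commute)
  finally show "volterra T (u \<alpha>) \<doteq> volterra T (pw T \<alpha>)" .
qed

lemma u_eq_pw: "\<alpha> > 0 \<Longrightarrow> u \<alpha> \<doteq> pw T \<alpha>"
proof -
  assume \<alpha>: "\<alpha> > 0"
  obtain \<alpha>\<^sub>0 where large: "\<And>\<alpha>. \<alpha> > \<alpha>\<^sub>0 \<Longrightarrow> u \<alpha> \<doteq> pw T \<alpha>" using u_large by blast
  \<comment> \<open>Here n counts unit steps from \<alpha> to beyond
    \<open>\<alpha>\<^sub>0\<close>, each undone by one descent.\<close>
  have "u \<alpha> \<doteq> pw T \<alpha>" if "\<alpha> > 0" "\<alpha> + real n > \<alpha>\<^sub>0" for n \<alpha>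
    using that
  proof (induction n arbitrary: \<alpha>)
    case 0
    then show ?case by (intro large) simp
  next
    case (Suc n)
    then have "u (\<alpha> + 1) \<doteq> pw T (\<alpha> + 1)" by (intro Suc.IH) auto
    then show ?case by (rule u_eq_pw_descend[OF Suc.prems(1)])
  qed
  moreover obtain n where "real n > \<alpha>\<^sub>0 - \<alpha>" using reals_Archimedean2 by blast
  ultimately show ?thesis using \<alpha> by (metis diff_less_eq add.commute)
qed

text \<open>The kernel \<open>pw T \<alpha>\<close> of the integrated operator is itself the
  integral of \<open>pw T (\<alpha> - 1)\<close>. Pulling this integration out of the convolution
  and cancelling it on both sides leaves the kernel of order \<alpha>.\<close>

theorem K_eq_conv:
  assumes \<alpha>: "\<alpha> > 0" and f: "f \<in> L1b T"
  shows "K \<alpha> f \<doteq> restr T (conv (pw T (\<alpha> - 1)) f)"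
proof (rule prim_inj_volterra[OF K_in[OF \<alpha> f] _ T])
  have pw: "pw T \<alpha> \<in> L1b T" "pw T (\<alpha> - 1) \<in> L1b T" using \<alpha> T by (auto intro!: pw_L1b)
  show "restr T (conv (pw T (\<alpha> - 1)) f) \<in> L1b T" using pw f by (intro restr_conv_L1b)
  have "conv (u \<alpha>) f = conv (pw T \<alpha>) f"
    using conv_AE_cong[OF u_eq_pw[OF \<alpha>] L1bD(2)[OF u_L1b[OF \<alpha>]] L1bD(2)[OF pw(1)] L1bD(2)[OF f]]
    by (simp only: conv_commute[of _ f])
  also have "pw T \<alpha> = volterra T (pw T (\<alpha> - 1))" using volterra_pw[of "\<alpha> - 1" T] \<alpha> T by simp
  finally show "volterra T (K \<alpha> f) \<doteq> volterra T (restr T (conv (pw T (\<alpha> - 1)) f))"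
    using volterra_K_eq_conv[OF \<alpha> f] volterra_conv[OF pw(2) f] by simp
qed

end

subsection \<open>Transfer to Lebesgue representatives\<close>

lemma L1_eq_iff: "L1_eq T f g \<longleftrightarrow> (AE x in lborel. x \<in> {0<..<T} \<longrightarrow> f x = g x)"
  unfolding L1_eq_def by (subst AE_restrict_space_iff) (auto simp: AE_completion_iff)

lemma L1_eq_sym: "L1_eq T f g \<Longrightarrow> L1_eq T g f"
  unfolding L1_eq_iff by (auto elim: eventually_mono)

lemma L1_eq_trans [trans]: "L1_eq T f g \<Longrightarrow> L1_eq T g h \<Longrightarrow> L1_eq T f h"
  unfolding L1_eq_iff by (auto elim: eventually_elim2)

lemma L1_eq_L1b: "f \<in> L1b T \<Longrightarrow> g \<in> L1b T \<Longrightarrow> L1_eq T f g \<longleftrightarrow> f \<doteq> g"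
  unfolding L1_eq_iff
  by (intro iffI; elim eventually_mono) (metis L1bD(3))+

lemma L1b_indicator: "f \<in> L1b T \<Longrightarrow> (\<lambda>x. indicator {0<..<T} x * f x) = f"
  by (rule ext) (use L1bD(3)[of f T] in \<open>fastforce simp: indicator_def\<close>)

lemma L1b_L1: "f \<in> L1b T \<Longrightarrow> f \<in> L1 T"
  unfolding L1_def
  by (simp add: integrable_restrict_space L1b_indicator integrable_completion L1bD)

text \<open>A Lebesgue measurable function agrees almost everywhere with a Borel one, which is then
  cut off to (0,T).\<close>

lemma ex_L1b:
  assumes "f \<in> L1 T" shows "\<exists>g\<in>L1b T. L1_eq T f g"
proof -
  let ?F = "\<lambda>x. indicator {0<..<T} x *\<^sub>R f x"
  have F: "integrable lebesgue ?F"
    using assms by (simp add: L1_def integrable_restrict_space)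
  from completion_ex_borel_measurable_real[OF borel_measurable_integrable[OF F]]
  obtain g where [measurable]: "g \<in> borel_measurable lborel" and g: "AE x in lborel. ?F x = g x"
    by blast
  have ae_eq_g: "AE x in lebesgue. ?F x = g x" by (rule AE_completion[OF g])
  have "integrable lebesgue g"
    by (rule integrable_cong_AE_imp[OF F _ ae_eq_g]) (intro measurable_completion, measurable)
  then have "restr T g \<in> L1b T"
    by (intro restr_L1b) (simp add: integrable_completion)
  moreover have "L1_eq T f (restr T g)"
    unfolding L1_eq_iff using g by eventually_elim (auto simp: restr_def indicator_def)
  ultimately show ?thesis by blast
qed

text \<open>An arbitrary choice; any two candidates agree almost everywhere, and the operators
  respect this.\<close>

definition borel_rep :: "real \<Rightarrow> (real \<Rightarrow> real) \<Rightarrow> real \<Rightarrow> real" where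
  "borel_rep T f = (SOME g. g \<in> L1b T \<and> L1_eq T f g)"

lemma borel_rep:
  assumes "f \<in> L1 T" shows "borel_rep T f \<in> L1b T" "L1_eq T f (borel_rep T f)"
  using someI_ex[of "\<lambda>g. g \<in> L1b T \<and> L1_eq T f g"] ex_L1b[OF assms]
  unfolding borel_rep_def by blast+

lemma L1_dist_L1b:
  assumes "f \<in> L1b T" "g \<in> L1b T" shows "L1_dist T f g = norm1 (\<lambda>x. f x - g x)"
proof -
  note d = L1b_diff[OF assms]
  have "(\<lambda>x. \<bar>f x - g x\<bar>) \<in> L1b T"
    using d by (auto simp: L1b_def)
  then show ?thesis
    unfolding L1_dist_def norm1_def
    by (simp add: integral_restrict_space L1b_indicator[of "\<lambda>x. \<bar>f x - g x\<bar>"] integral_completion L1bD)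
qed

lemma L1_dist_cong:
  assumes "f \<in> L1 T" "f' \<in> L1 T" "g \<in> L1 T" "g' \<in> L1 T" "L1_eq T f f'" "L1_eq T g g'"
  shows "L1_dist T f g = L1_dist T f' g'"
  unfolding L1_dist_def
proof (rule integral_cong_AE)
  have "(\<lambda>t. \<bar>f t - g t\<bar>) \<in> borel_measurable (lebesgue_on {0<..<T})" if "f \<in> L1 T" "g \<in> L1 T" for f g
    using that by (auto simp: L1_def)
  then show "(\<lambda>t. \<bar>f t - g t\<bar>) \<in> borel_measurable (lebesgue_on {0<..<T})"
    "(\<lambda>t. \<bar>f' t - g' t\<bar>) \<in> borel_measurable (lebesgue_on {0<..<T})"
    using assms by blast+
  show "AE t in lebesgue_on {0<..<T}. \<bar>f t - g t\<bar> = \<bar>f' t - g' t\<bar>"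
    using assms(5,6) unfolding L1_eq_def by eventually_elim simp
qed

lemma ordinary_integral_eq_volterra:
  assumes f: "f \<in> L1b T"
  shows "L1_eq T (ordinary_integral f) (volterra T f)"
  unfolding L1_eq_iff
proof (intro always_eventually allI impI)
  fix t assume t: "t \<in> {0<..<T}"
  have [measurable]: "f \<in> borel_measurable borel" using f by (rule L1bD)
  have "ordinary_integral f t = (\<integral>x. indicator {0<..<t} x *\<^sub>R f x \<partial>lborel)"
    unfolding ordinary_integral_def by (simp add: integral_restrict_space integral_completion)
  also have "\<dots> = prim f t"
    unfolding prim_def
  proof (intro Bochner_Integration.integral_cong refl)
    fix x show "indicator {0<..<t} x *\<^sub>R f x = indicator {..<t} x * f x"
      using L1bD(3)[OF f, of x] by (cases "x \<le> 0") (auto simp: indicator_def)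
  qed
  finally show "ordinary_integral f t = volterra T f t" using t by (simp add: volterra_def restr_def)
qed

text \<open>The values agree at every t in (0,T), exceptional points with default value included: f
  and g differ on a null set, and the vanishing of \<open>pw\<close> at nonpositive arguments
  restricts the convolution to s < t.\<close>

lemma riemann_liouville_eq_conv:
  assumes f: "f \<in> L1 T" and g: "g \<in> L1b T" and fg: "L1_eq T f g"
  shows "L1_eq T (riemann_liouville \<alpha> f) (restr T (conv (pw T (\<alpha> - 1)) g))"
  unfolding L1_eq_iff
proof (intro always_eventually allI impI)
  fix t assume t: "t \<in> {0<..<T}"
  have [measurable]: "g \<in> borel_measurable borel" using g by (rule L1bD)
  have fm: "f \<in> borel_measurable (lebesgue_on {0<..<t})"
    by (rule measurable_restrict_mono[of _ _ "{0<..<T}"]) (use f t in \<open>auto simp: L1_def\<close>)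
  have gm: "g \<in> borel_measurable (lebesgue_on {0<..<t})"
    by (intro measurable_restrict_space1 measurable_completion) simp
  have pm: "(\<lambda>s. (t - s) powr (\<alpha> - 1)) \<in> borel_measurable (lebesgue_on {0<..<t})"
    by (intro measurable_restrict_space1 measurable_completion) measurable
  have "(\<integral>s. (t - s) powr (\<alpha> - 1) * f s \<partial>lebesgue_on {0<..<t})
      = (\<integral>s. (t - s) powr (\<alpha> - 1) * g s \<partial>lebesgue_on {0<..<t})"
  proof (rule integral_cong_AE)
    have "AE x in lborel. x \<in> {0<..<t} \<longrightarrow> f x = g x"
      using fg t unfolding L1_eq_iff by (auto elim: eventually_mono)
    then have "L1_eq t f g" by (simp add: L1_eq_iff)
    then show "AE s in lebesgue_on {0<..<t}. (t - s) powr (\<alpha> - 1) * f s = (t - s) powr (\<alpha> - 1) * g s"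
      unfolding L1_eq_def by (auto elim: eventually_mono)
  qed (intro borel_measurable_times pm fm gm)+
  also have "\<dots> = (\<integral>s. indicator {0<..<t} s *\<^sub>R ((t - s) powr (\<alpha> - 1) * g s) \<partial>lborel)"
    by (simp add: integral_restrict_space integral_completion)
  finally have "riemann_liouville \<alpha> f t
      = (\<integral>s. 1 / Gamma \<alpha> * (indicator {0<..<t} s *\<^sub>R ((t - s) powr (\<alpha> - 1) * g s)) \<partial>lborel)"
    by (simp add: riemann_liouville_def)
  also have "\<dots> = conv (pw T (\<alpha> - 1)) g t"
    unfolding conv_def
  proof (intro Bochner_Integration.integral_cong refl)
    fix s show "1 / Gamma \<alpha> * (indicator {0<..<t} s *\<^sub>R ((t - s) powr (\<alpha> - 1) * g s)) = pw T (\<alpha> - 1) (t - s) * g s"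
      using L1bD(3)[OF g, of s] t by (cases "s \<in> {0<..<T}") (auto simp: pw_def restr_def indicator_def)
  qed
  finally show "riemann_liouville \<alpha> f t = restr T (conv (pw T (\<alpha> - 1)) g) t"
    using t by (simp add: restr_def)
qed

theorem corollary4p6:
  fixes T :: real and J :: "real \<Rightarrow> (real \<Rightarrow> real) \<Rightarrow> (real \<Rightarrow> real)"
  assumes "T > 0"
    and "\<And>\<alpha>. \<alpha> > 0 \<Longrightarrow> L1_operator T (J \<alpha>)"
    and "\<And>\<alpha>. \<alpha> > 0 \<Longrightarrow> L1_linear T (J \<alpha>)"
    and "\<And>\<alpha>. \<alpha> > 0 \<Longrightarrow> L1_continuous T (J \<alpha>)"
    and identity: "\<And>f. f \<in> L1 T \<Longrightarrow> L1_eq T (J 1 f) (ordinary_integral f)"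
    and index_law: "\<And>\<alpha> \<beta> f. \<alpha> > 0 \<Longrightarrow> \<beta> > 0 \<Longrightarrow> f \<in> L1 T \<Longrightarrow>
          L1_eq T (J (\<alpha> + \<beta>) f) (J \<alpha> (J \<beta> f))"
    and continuity: "\<exists>\<alpha>\<^sub>0>0. ((\<lambda>\<alpha>. L1_dist T (J \<alpha> (\<lambda>_. 1)) (J \<alpha>\<^sub>0 (\<lambda>_. 1))) \<longlongrightarrow> 0)
          (at \<alpha>\<^sub>0 within {0<..})"
  shows "\<forall>\<alpha>>0. \<forall>f\<in>L1 T. L1_eq T (J \<alpha> f) (riemann_liouville \<alpha> f)"
proof -
  note T = assms(1)
  \<comment> \<open>Borel representatives of the values of J; each hypothesis on J passes to K along
    \<open>L1_eq\<close>.\<close>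
  define K where "K = (\<lambda>\<alpha> f. borel_rep T (J \<alpha> f))"
  have J_in: "J \<alpha> f \<in> L1 T" if "\<alpha> > 0" "f \<in> L1 T" for \<alpha> f
    using assms(2)[of \<alpha>] that by (simp add: L1_operator_def)
  have J_cong: "L1_eq T (J \<alpha> f) (J \<alpha> g)" if "\<alpha> > 0" "f \<in> L1 T" "g \<in> L1 T" "L1_eq T f g" for \<alpha> f g
    using assms(2)[of \<alpha>] that by (simp add: L1_operator_def)
  have K_in: "K \<alpha> f \<in> L1b T" and K_J: "L1_eq T (K \<alpha> f) (J \<alpha> f)" if "\<alpha> > 0" "f \<in> L1 T" for \<alpha> f
    unfolding K_def using borel_rep[OF J_in[OF that]] by (auto intro: L1_eq_sym)
  let ?one = "restr T (\<lambda>_. 1)"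
  have one: "?one \<in> L1b T" using restr_bounded_L1b(1)[of "\<lambda>_. 1" T 1] T by simp
  have one': "(\<lambda>_. 1) \<in> L1 T"
  proof -
    have "(\<lambda>x. indicator {0<..<T} x *\<^sub>R 1) = restr T (\<lambda>_. 1::real)" by (simp add: restr_def[abs_def])
    then show ?thesis
      unfolding L1_def using L1bD(1,2)[OF one]
      by (simp only: mem_Collect_eq) (subst integrable_restrict_space, auto simp: integrable_completion)
  qed
  have one_eq: "L1_eq T ?one (\<lambda>_. 1)"
    unfolding L1_eq_iff by (simp add: restr_def)
  have dist: "L1_dist T (J \<alpha> f) (J \<beta> g) = norm1 (\<lambda>x. K \<alpha> f x - K \<beta> g x)"
    if "\<alpha> > 0" "\<beta> > 0" "f \<in> L1 T" "g \<in> L1 T" for \<alpha> \<beta> f g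
    using that L1_dist_cong[OF _ _ _ _ K_J[of \<alpha> f] K_J[of \<beta> g]]
    by (simp add: K_in J_in L1b_L1 L1_dist_L1b)
  interpret frac_family T K
  proof
    fix \<alpha> :: real and f g assume \<alpha>: "\<alpha> > 0" and f: "f \<in> L1b T" and g: "g \<in> L1b T"
    note f' = L1b_L1[OF f] and g' = L1b_L1[OF g]
    { assume "f \<doteq> g"
      then have "L1_eq T f g" using f g by (simp add: L1_eq_L1b)
      then have "L1_eq T (K \<alpha> f) (K \<alpha> g)"
        using K_J[OF \<alpha> f'] K_J[OF \<alpha> g'] J_cong[OF \<alpha> f' g'] by (meson L1_eq_sym L1_eq_trans)
      then show "K \<alpha> f \<doteq> K \<alpha> g" using K_in \<alpha> f' g' by (simp add: L1_eq_L1b) }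
    note fg = L1b_add[OF f g]
    have "L1_eq T (J \<alpha> (\<lambda>t. f t + g t)) (\<lambda>t. J \<alpha> f t + J \<alpha> g t)"
      using assms(3)[OF \<alpha>] f' g' by (simp add: L1_linear_def)
    then have "L1_eq T (K \<alpha> (\<lambda>t. f t + g t)) (\<lambda>t. K \<alpha> f t + K \<alpha> g t)"
      using K_J[OF \<alpha> f'] K_J[OF \<alpha> g'] K_J[OF \<alpha> L1b_L1[OF fg]]
      unfolding L1_eq_def by eventually_elim simp
    then show "K \<alpha> (\<lambda>t. f t + g t) \<doteq> (\<lambda>t. K \<alpha> f t + K \<alpha> g t)"
      using L1_eq_L1b[OF K_in[OF \<alpha> L1b_L1[OF fg]] L1b_add[OF K_in[OF \<alpha> f'] K_in[OF \<alpha> g']]] by blast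
  next
    fix \<alpha> c :: real and f assume \<alpha>: "\<alpha> > 0" and f: "f \<in> L1b T"
    note f' = L1b_L1[OF f] and cf = L1b_L1[OF L1b_mult[OF f, of c]]
    have "L1_eq T (J \<alpha> (\<lambda>t. c * f t)) (\<lambda>t. c * J \<alpha> f t)"
      using assms(3)[OF \<alpha>] f' by (simp add: L1_linear_def)
    then have "L1_eq T (K \<alpha> (\<lambda>t. c * f t)) (\<lambda>t. c * K \<alpha> f t)"
      using K_J[OF \<alpha> f'] K_J[OF \<alpha> cf]
      unfolding L1_eq_def by eventually_elim simp
    then show "K \<alpha> (\<lambda>t. c * f t) \<doteq> (\<lambda>t. c * K \<alpha> f t)"
      using L1_eq_L1b[OF K_in[OF \<alpha> cf] L1b_mult[OF K_in[OF \<alpha> f'], of c]] by blast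
  next
    fix \<alpha> \<epsilon> :: real and f assume \<alpha>: "\<alpha> > 0" and f: "f \<in> L1b T" and \<epsilon>: "\<epsilon> > 0"
    obtain \<delta> where "\<delta> > 0" and \<delta>: "\<And>g. g \<in> L1 T \<Longrightarrow> L1_dist T g f < \<delta> \<Longrightarrow> L1_dist T (J \<alpha> g) (J \<alpha> f) < \<epsilon>"
      using assms(4)[OF \<alpha>] L1b_L1[OF f] \<epsilon> unfolding L1_continuous_def by blast
    have "norm1 (\<lambda>x. K \<alpha> g x - K \<alpha> f x) < \<epsilon>" if "g \<in> L1b T" "norm1 (\<lambda>x. g x - f x) < \<delta>" for g
      using \<delta>[OF L1b_L1[OF that(1)]] that f by (simp add: L1_dist_L1b dist \<alpha> L1b_L1)
    then show "\<exists>\<delta>>0. \<forall>g\<in>L1b T. norm1 (\<lambda>x. g x - f x) < \<delta> \<longrightarrow> norm1 (\<lambda>x. K \<alpha> g x - K \<alpha> f x) < \<epsilon>"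
      using \<open>\<delta> > 0\<close> by blast
  next
    fix f assume f: "f \<in> L1b T"
    note f' = L1b_L1[OF f]
    have "L1_eq T (K 1 f) (J 1 f)" using f' by (intro K_J) auto
    also have "L1_eq T (J 1 f) (ordinary_integral f)" by (rule identity[OF f'])
    also have "L1_eq T (ordinary_integral f) (volterra T f)" by (rule ordinary_integral_eq_volterra[OF f])
    finally show "K 1 f \<doteq> volterra T f"
      using L1_eq_L1b[OF K_in volterra_L1b] f f' T by simp
  next
    fix \<alpha> \<beta> :: real and f assume \<alpha>: "\<alpha> > 0" and \<beta>: "\<beta> > 0" and f: "f \<in> L1b T"
    note f' = L1b_L1[OF f] and Kf = L1b_L1[OF K_in[OF \<beta> L1b_L1[OF f]]]
    have "L1_eq T (K (\<alpha> + \<beta>) f) (J (\<alpha> + \<beta>) f)" using f' \<alpha> \<beta> by (intro K_J) auto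
    also have "L1_eq T (J (\<alpha> + \<beta>) f) (J \<alpha> (J \<beta> f))" by (rule index_law[OF \<alpha> \<beta> f'])
    also have "L1_eq T (J \<alpha> (J \<beta> f)) (J \<alpha> (K \<beta> f))"
      by (rule J_cong[OF \<alpha> J_in[OF \<beta> f'] Kf L1_eq_sym[OF K_J[OF \<beta> f']]])
    also have "L1_eq T (J \<alpha> (K \<beta> f)) (K \<alpha> (K \<beta> f))"
      by (rule L1_eq_sym[OF K_J[OF \<alpha> Kf]])
    finally show "K (\<alpha> + \<beta>) f \<doteq> K \<alpha> (K \<beta> f)"
      using L1_eq_L1b[OF K_in K_in] f' Kf \<alpha> \<beta> by simp
  next
    obtain \<alpha>\<^sub>0 where \<alpha>\<^sub>0: "\<alpha>\<^sub>0 > 0" and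
      lim: "((\<lambda>\<alpha>. L1_dist T (J \<alpha> (\<lambda>_. 1)) (J \<alpha>\<^sub>0 (\<lambda>_. 1))) \<longlongrightarrow> 0) (at \<alpha>\<^sub>0 within {0<..})"
      using continuity by blast
    \<comment> \<open>The half-line is open, so near \<open>\<alpha>\<^sub>0\<close> it imposes no
      restriction.\<close>
    have at: "at \<alpha>\<^sub>0 within {0<..} = at \<alpha>\<^sub>0" using \<alpha>\<^sub>0 by (intro at_within_open) auto
    have eq: "L1_dist T (J \<alpha> (\<lambda>_. 1)) (J \<alpha>\<^sub>0 (\<lambda>_. 1)) = norm1 (\<lambda>x. K \<alpha> ?one x - K \<alpha>\<^sub>0 ?one x)" if "\<alpha> > 0" for \<alpha>
    proof -
      \<comment> \<open>The constant 1 on the whole line does not lie in \<open>L1b T\<close>; its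
        truncation does and represents the same element.\<close>
      have "L1_eq T (J \<beta> (\<lambda>_. 1)) (J \<beta> ?one)" if "\<beta> > 0" for \<beta>
        by (intro J_cong that one' L1b_L1[OF one] L1_eq_sym[OF one_eq])
      then have "L1_dist T (J \<alpha> (\<lambda>_. 1)) (J \<alpha>\<^sub>0 (\<lambda>_. 1)) = L1_dist T (J \<alpha> ?one) (J \<alpha>\<^sub>0 ?one)"
        using that \<alpha>\<^sub>0 by (intro L1_dist_cong J_in one' L1b_L1[OF one]) auto
      then show ?thesis using dist[OF that \<alpha>\<^sub>0] L1b_L1[OF one] by simp
    qed
    have "\<forall>\<^sub>F \<alpha> in at \<alpha>\<^sub>0. \<alpha> > 0"
      by (rule order_tendstoD(1)[OF tendsto_ident_at \<alpha>\<^sub>0])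
    then have "\<forall>\<^sub>F \<alpha> in at \<alpha>\<^sub>0. L1_dist T (J \<alpha> (\<lambda>_. 1)) (J \<alpha>\<^sub>0 (\<lambda>_. 1))
        = norm1 (\<lambda>x. K \<alpha> ?one x - K \<alpha>\<^sub>0 ?one x)"
      by (rule eventually_mono) (rule eq)
    with lim have "((\<lambda>\<alpha>. norm1 (\<lambda>x. K \<alpha> ?one x - K \<alpha>\<^sub>0 ?one x)) \<longlongrightarrow> 0) (at \<alpha>\<^sub>0)"
      unfolding at by (rule Lim_transform_eventually)
    then show "\<exists>\<alpha>\<^sub>0>0. ((\<lambda>\<alpha>. norm1 (\<lambda>x. K \<alpha> ?one x - K \<alpha>\<^sub>0 ?one x)) \<longlongrightarrow> 0) (at \<alpha>\<^sub>0)"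
      using \<alpha>\<^sub>0 by blast
  qed (use T K_in L1b_L1 in auto)
  show ?thesis
  proof (intro allI impI ballI)
    fix \<alpha> :: real and f assume \<alpha>: "\<alpha> > 0" and f: "f \<in> L1 T"
    define g where "g = borel_rep T f"
    have g: "g \<in> L1b T" "L1_eq T f g" using borel_rep[OF f] by (simp_all add: g_def)
    have pw: "pw T (\<alpha> - 1) \<in> L1b T" using \<alpha> T by (intro pw_L1b) auto
    have "L1_eq T (J \<alpha> f) (J \<alpha> g)" using J_cong \<alpha> f g L1b_L1 by blast
    also have "L1_eq T (J \<alpha> g) (K \<alpha> g)" using K_J[OF \<alpha> L1b_L1[OF g(1)]] by (rule L1_eq_sym)
    also have "L1_eq T (K \<alpha> g) (restr T (conv (pw T (\<alpha> - 1)) g))"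
      using K_eq_conv[OF \<alpha> g(1)] unfolding L1_eq_iff by (auto elim: eventually_mono)
    also have "L1_eq T (restr T (conv (pw T (\<alpha> - 1)) g)) (riemann_liouville \<alpha> f)"
      by (rule L1_eq_sym[OF riemann_liouville_eq_conv[OF f g]])
    finally show "L1_eq T (J \<alpha> f) (riemann_liouville \<alpha> f)" .
  qed
qed

end
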